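(* Let $\mathcal{E}$ be a non-zero separable Hilbert space, and let $k$ be the scalar-valued kernel on $\mathbb{D}$ given by $$k(z,w)=\sum_{n\ge 0}\beta_n^2z^n\bar{w}^n\qquad(z,w\in\mathbb{D}),$$ where $\{\beta_n\}_{n\ge 0}$ are positive numbers with $\limsup_n\frac{\beta_{n+1}}{\beta_n}\le 1$. Let $\mathcal{H}_{\mathcal{E}}(K)$ denote the reproducing kernel Hilbert space corresponding to the kernel $K(z,w)=k(z,w)I_{\mathcal{E}}$, $z,w\in\mathbb{D}$. Suppose that $\{A_j\}_{j=0}^d\subseteq\mathcal{B}(\mathcal{E})$, that $A_0$ is injective, that $$P(z)=A_0+A_1z+\cdots+A_dz^d,$$ and let $\mathcal{H}_P$ denote the reproducing kernel Hilbert space corresponding to the kernel function $$K_P(z,w)=P(z)K(z,w)P(w)^*\qquad(z,w\in\mathbb{D}).$$ If the multiplication operator $M_z$ is bounded on $\mathcal{H}_P$, then the following are equivalent: (i) $M_z^*$ (on $\mathcal{H}_P$) is hypercyclic. (ii) $\displaystyle\liminf_n\left(\frac{1}{(n!)^2}\Big\langle\Big(\frac{\partial^{2n}K_P}{\partial z^n\partial\bar{w}^n}(0,0)\Big)\eta,\eta\Big\rangle_{\mathcal{E}}\right)=0$ uniformly in $\eta\in\mathcal{E}_1$, where $\mathcal{E}_1$ is the open unit ball in $\mathcal{E}$. (iii) $\displaystyle\liminf_n\beta_n=0$.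
   Context: $\mathbb{D}$ is the open unit disc in $\mathbb{C}$; inner products are linear in the first variable. For a Hilbert space $\mathcal{E}$, a function $K:\mathbb{D}\times\mathbb{D}\to\mathcal{B}(\mathcal{E})$ is an analytic kernel if $K$ is analytic in the first variable and $\sum_{i,j=1}^n\langle K(z_i,z_j)\eta_j,\eta_i\rangle_{\mathcal{E}}\ge 0$ for all $n\in\mathbb{N}$, $z_1,\dots,z_n\in\mathbb{D}$, $\eta_1,\dots,\eta_n\in\mathcal{E}$. (Then $K(z,w)^*=K(w,z)$, so $K$ is co-analytic in $w$ and derivatives in $\bar w$ make sense.) The corresponding analytic reproducing kernel Hilbert space $\mathcal{H}_{\mathcal{E}}(K)$ is the Hilbert space of $\mathcal{E}$-valued analytic functions on $\mathbb{D}$ in which $\{K(\cdot,w)\eta: w\in\mathbb{D},\eta\in\mathcal{E}\}$ is total and $\langle f,K(\cdot,w)\eta\rangle_{\mathcal{H}_{\mathcal{E}}(K)}=\langle f(w),\eta\rangle_{\mathcal{E}}$ for all $f\in\mathcal{H}_{\mathcal{E}}(K)$, $w\in\mathbb{D}$, $\eta\in\mathcal{E}$. The space $\mathcal{H}_P$ can be described as $\mathcal{H}_P=\{Pf: f\in\mathcal{H}_{\mathcal{E}}(K)\}$, $(Pf)(z)=P(z)f(z)$, with inner product $\langle Pf,Pg\rangle_{\mathcal{H}_P}=\langle f,g\rangle_{\mathcal{H}_{\mathcal{E}}(K)}$. $M_z$ is the operator $(M_zf)(w)=wf(w)$, and $M_z^*$ is its adjoint. For a set $I$ and complex-valued functions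 $u_n$ on $I$, "$\liminf_n u_n(x)=0$ uniformly in $x\in I$" means that there is a (strictly increasing) subsequence $\{n_k\}$ of the natural numbers such that $\lim_{k\to\infty}u_{n_k}(x)=0$ uniformly in $x\in I$. A bounded linear operator $T$ on a Banach space $X$ is hypercyclic if there is $x\in X$ with $\{x,Tx,T^2x,\dots\}$ dense in $X$. *)

theory Defs
  imports "HOL-Analysis.Analysis"
begin

section \<open>Complex Hilbert spaces\<close>

text \<open>
  A complex Hilbert space extends the real Hilbert space with inner product
  Re \<open>\<langle>x, y\<rangle>\<close>, so norm, topology and completeness are those of the library classes.
  The complex inner product is linear in the first variable.
\<close>

class complex_hilbert = real_inner + banach +
  fixes scaleC :: "complex \<Rightarrow> 'a \<Rightarrow> 'a"  (infixr "*\<^sub>C" 75)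
    and cinner :: "'a \<Rightarrow> 'a \<Rightarrow> complex"
  assumes scaleC_add_right: "c *\<^sub>C (x + y) = c *\<^sub>C x + c *\<^sub>C y"
    and scaleC_add_left: "(b + c) *\<^sub>C x = b *\<^sub>C x + c *\<^sub>C x"
    and scaleC_scaleC: "b *\<^sub>C c *\<^sub>C x = (b * c) *\<^sub>C x"
    and scaleC_of_real: "complex_of_real r *\<^sub>C x = r *\<^sub>R x"
    and cinner_commute: "cinner x y = cnj (cinner y x)"
    and cinner_add_left: "cinner (x + y) z = cinner x z + cinner y z"
    and cinner_scaleC_left: "cinner (c *\<^sub>C x) y = c * cinner x y"
    and Re_cinner: "Re (cinner x y) = inner x y"

instantiation complex :: complex_hilbert
begin

definition scaleC_complex :: "complex \<Rightarrow> complex \<Rightarrow> complex"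
  where "scaleC_complex c x = c * x"

definition cinner_complex :: "complex \<Rightarrow> complex \<Rightarrow> complex"
  where "cinner_complex x y = x * cnj y"

instance
  by standard
    (simp_all add: scaleC_complex_def cinner_complex_def inner_complex_def
       algebra_simps scaleR_conv_of_real)

end

lemma cinner_self: "cinner x x = complex_of_real ((norm x)\<^sup>2)"
  for x :: "'a::complex_hilbert"
proof (rule complex_eqI)
  show "Re (cinner x x) = Re (complex_of_real ((norm x)\<^sup>2))"
    by (simp add: Re_cinner power2_norm_eq_inner)
  have "Im (cinner x x) = - Im (cinner x x)"
    using arg_cong[OF cinner_commute[of x x], of Im] by simp
  then show "Im (cinner x x) = Im (complex_of_real ((norm x)\<^sup>2))"
    by simp
qed

lemma cinner_scaleC_right: "cinner x (c *\<^sub>C y) = cnj c * cinner x y"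
  for x y :: "'a::complex_hilbert"
  by (metis cinner_commute cinner_scaleC_left complex_cnj_mult)

lemma norm_scaleC: "norm (c *\<^sub>C x) = cmod c * norm x"
  for x :: "'a::complex_hilbert"
proof -
  have "complex_of_real ((norm (c *\<^sub>C x))\<^sup>2) = c * cnj c * complex_of_real ((norm x)\<^sup>2)"
    by (simp only: cinner_self[symmetric] cinner_scaleC_left cinner_scaleC_right mult.assoc mult.left_commute)
  also have "\<dots> = complex_of_real ((cmod c * norm x)\<^sup>2)"
    by (simp add: complex_norm_square[symmetric] power_mult_distrib)
  finally have "(norm (c *\<^sub>C x))\<^sup>2 = (cmod c * norm x)\<^sup>2"
    using of_real_eq_iff by blast
  then show ?thesis
    by (simp add: power2_eq_iff_nonneg)
qed

lemma bounded_linear_scaleC: "bounded_linear (\<lambda>x::'a::complex_hilbert. c *\<^sub>C x)"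
proof (rule bounded_linear_intro)
  fix x y :: 'a and r :: real
  show "c *\<^sub>C (x + y) = c *\<^sub>C x + c *\<^sub>C y"
    by (rule scaleC_add_right)
  show "c *\<^sub>C (r *\<^sub>R x) = r *\<^sub>R (c *\<^sub>C x)"
    by (metis mult.commute scaleC_of_real scaleC_scaleC)
  show "norm (c *\<^sub>C x) \<le> norm x * cmod c"
    by (simp add: norm_scaleC mult.commute)
qed

definition cspan :: "'a::complex_hilbert set \<Rightarrow> 'a set"
  where "cspan S = span {c *\<^sub>C x |c x. x \<in> S}"

definition total :: "'a::complex_hilbert set \<Rightarrow> bool"
  where "total S \<longleftrightarrow> closure (cspan S) = UNIV"


section \<open>Bounded operators\<close>

text \<open>
  The library type \<open>'a \<Rightarrow>\<^sub>L 'b\<close> consists of the bounded real-linear maps;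
  \<open>\<B>(\<E>)\<close> is its subset of complex-linear maps, with the same operator norm.
\<close>

definition complex_linear :: "('a::complex_hilbert \<Rightarrow>\<^sub>L 'b::complex_hilbert) \<Rightarrow> bool"
  where "complex_linear T \<longleftrightarrow>
    (\<forall>c x. blinfun_apply T (c *\<^sub>C x) = c *\<^sub>C blinfun_apply T x)"

lift_definition scaleC_blinfun ::
  "complex \<Rightarrow> ('a::complex_hilbert \<Rightarrow>\<^sub>L 'b::complex_hilbert) \<Rightarrow> ('a \<Rightarrow>\<^sub>L 'b)"
  is "\<lambda>c T x. c *\<^sub>C T x"
  by (rule bounded_linear_compose[OF bounded_linear_scaleC])

definition cadjoint ::
  "('a::complex_hilbert \<Rightarrow>\<^sub>L 'b::complex_hilbert) \<Rightarrow> ('b \<Rightarrow>\<^sub>L 'a)"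
  where "cadjoint T =
    (THE S. \<forall>x y. cinner (blinfun_apply T x) y = cinner x (blinfun_apply S y))"

definition hypercyclic :: "('a::banach \<Rightarrow>\<^sub>L 'a) \<Rightarrow> bool"
  where "hypercyclic T \<longleftrightarrow>
    (\<exists>x. closure (range (\<lambda>n. (blinfun_apply T ^^ n) x)) = UNIV)"


section \<open>Analytic reproducing kernel Hilbert spaces on the disc\<close>

abbreviation disc :: "complex set"
  where "disc \<equiv> ball 0 1"

definition analytic_on_disc :: "(complex \<Rightarrow> 'e::complex_hilbert) \<Rightarrow> bool"
  where "analytic_on_disc f \<longleftrightarrow>
    (\<forall>z\<in>disc. \<exists>f'. (f has_derivative (\<lambda>h. h *\<^sub>C f')) (at z))"

text \<open>
  A Hilbert space of functions on the disc is a Hilbert space type \<open>'h\<close> with a linear map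
  \<open>ev\<close> sending each element to the function it is; \<open>ev\<close> is injective as a map into functions
  on the disc (values outside the disc are irrelevant).

  \<open>f\<close> is the function \<open>K(\<cdot>, w)\<eta>\<close>:
\<close>

definition is_kernel_function ::
  "(complex \<Rightarrow> complex \<Rightarrow> 'e::complex_hilbert \<Rightarrow>\<^sub>L 'e) \<Rightarrow>
   ('h::complex_hilbert \<Rightarrow> complex \<Rightarrow> 'e) \<Rightarrow> complex \<Rightarrow> 'e \<Rightarrow> 'h \<Rightarrow> bool"
  where "is_kernel_function K ev w \<eta> f \<longleftrightarrow>
    (\<forall>z\<in>disc. ev f z = blinfun_apply (K z w) \<eta>)"

text \<open>
  That \<open>K\<close> is a positive kernel, analytic in the first variable, is implied by the following.
\<close>

definition analytic_rkhs ::
  "(complex \<Rightarrow> complex \<Rightarrow> 'e::complex_hilbert \<Rightarrow>\<^sub>L 'e) \<Rightarrow>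
   ('h::complex_hilbert \<Rightarrow> complex \<Rightarrow> 'e) \<Rightarrow> bool"
  where "analytic_rkhs K ev \<longleftrightarrow>
    (\<forall>c f g. \<forall>z\<in>disc. ev (c *\<^sub>C f + g) z = c *\<^sub>C ev f z + ev g z) \<and>
    (\<forall>f g. (\<forall>z\<in>disc. ev f z = ev g z) \<longrightarrow> f = g) \<and>
    (\<forall>f. analytic_on_disc (ev f)) \<and>
    (\<forall>w\<in>disc. \<forall>\<eta>. \<exists>k. is_kernel_function K ev w \<eta> k) \<and>
    total {k. \<exists>w\<in>disc. \<exists>\<eta>. is_kernel_function K ev w \<eta> k} \<and>
    (\<forall>w\<in>disc. \<forall>\<eta> k. is_kernel_function K ev w \<eta> k \<longrightarrow>
      (\<forall>f. cinner f k = cinner (ev f w) \<eta>))"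

text \<open>
  \<open>M\<close> is the operator \<open>M\<^sub>z\<close> on \<open>'h\<close>; since \<open>ev\<close> is injective there is at most one,
  and one exists iff \<open>M\<^sub>z\<close> is (everywhere defined and) bounded.
\<close>

definition is_Mz ::
  "('h::complex_hilbert \<Rightarrow> complex \<Rightarrow> 'e::complex_hilbert) \<Rightarrow> ('h \<Rightarrow>\<^sub>L 'h) \<Rightarrow> bool"
  where "is_Mz ev M \<longleftrightarrow>
    (\<forall>f. \<forall>w\<in>disc. ev (blinfun_apply M f) w = w *\<^sub>C ev f w)"


section \<open>Wirtinger derivatives of operator-valued functions\<close>

definition partial_x :: "(complex \<Rightarrow> 'v::real_normed_vector) \<Rightarrow> complex \<Rightarrow> 'v"
  where "partial_x F z = vector_derivative (\<lambda>t. F (z + complex_of_real t)) (at 0)"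

definition partial_y :: "(complex \<Rightarrow> 'v::real_normed_vector) \<Rightarrow> complex \<Rightarrow> 'v"
  where "partial_y F z = vector_derivative (\<lambda>t. F (z + \<i> * complex_of_real t)) (at 0)"

definition d_z ::
  "(complex \<Rightarrow> 'a::complex_hilbert \<Rightarrow>\<^sub>L 'b::complex_hilbert) \<Rightarrow> complex \<Rightarrow> 'a \<Rightarrow>\<^sub>L 'b"
  where "d_z F z = (1/2) *\<^sub>R (partial_x F z - scaleC_blinfun \<i> (partial_y F z))"

definition d_zbar ::
  "(complex \<Rightarrow> 'a::complex_hilbert \<Rightarrow>\<^sub>L 'b::complex_hilbert) \<Rightarrow> complex \<Rightarrow> 'a \<Rightarrow>\<^sub>L 'b"
  where "d_zbar F z = (1/2) *\<^sub>R (partial_x F z + scaleC_blinfun \<i> (partial_y F z))"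

text \<open>\<open>\<partial>\<^sup>m\<^sup>+\<^sup>n K / \<partial>z\<^sup>m \<partial>(cnj w)\<^sup>n\<close> at \<open>(z, w)\<close>.\<close>

definition mixed_derivative ::
  "nat \<Rightarrow> nat \<Rightarrow> (complex \<Rightarrow> complex \<Rightarrow> 'a::complex_hilbert \<Rightarrow>\<^sub>L 'b::complex_hilbert) \<Rightarrow>
   complex \<Rightarrow> complex \<Rightarrow> 'a \<Rightarrow>\<^sub>L 'b"
  where "mixed_derivative m n K z w = (d_z ^^ m) (\<lambda>u. (d_zbar ^^ n) (K u) w) z"


section \<open>The kernels\<close>

definition scalar_kernel :: "(nat \<Rightarrow> real) \<Rightarrow> complex \<Rightarrow> complex \<Rightarrow> complex"
  where "scalar_kernel \<beta> z w = (\<Sum>n. complex_of_real ((\<beta> n)\<^sup>2) * z ^ n * cnj w ^ n)"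

definition diagonal_kernel ::
  "(nat \<Rightarrow> real) \<Rightarrow> complex \<Rightarrow> complex \<Rightarrow> 'e::complex_hilbert \<Rightarrow>\<^sub>L 'e"
  where "diagonal_kernel \<beta> z w = scaleC_blinfun (scalar_kernel \<beta> z w) id_blinfun"

definition operator_poly ::
  "nat \<Rightarrow> (nat \<Rightarrow> 'e::complex_hilbert \<Rightarrow>\<^sub>L 'e) \<Rightarrow> complex \<Rightarrow> 'e \<Rightarrow>\<^sub>L 'e"
  where "operator_poly d A z = (\<Sum>j\<le>d. scaleC_blinfun (z ^ j) (A j))"

definition K\<^sub>P ::
  "(nat \<Rightarrow> real) \<Rightarrow> nat \<Rightarrow> (nat \<Rightarrow> 'e::complex_hilbert \<Rightarrow>\<^sub>L 'e) \<Rightarrow>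
   complex \<Rightarrow> complex \<Rightarrow> 'e \<Rightarrow>\<^sub>L 'e"
  where "K\<^sub>P \<beta> d A z w =
    operator_poly d A z o\<^sub>L diagonal_kernel \<beta> z w o\<^sub>L cadjoint (operator_poly d A w)"


section \<open>Uniform lower limits\<close>

definition liminf_zero_uniformly :: "'i set \<Rightarrow> (nat \<Rightarrow> 'i \<Rightarrow> complex) \<Rightarrow> bool"
  where "liminf_zero_uniformly I u \<longleftrightarrow>
    (\<exists>r. strict_mono r \<and> uniform_limit I (\<lambda>k. u (r k)) (\<lambda>_. 0) sequentially)"

end

theory Submission
  imports Defs
begin

text \<open>
  In \<open>\<H>\<^sub>P\<close> the function \<open>\<beta>\<^sub>n z\<^sup>n P(z)\<xi>\<close> has norm at most \<open>\<parallel>\<xi>\<parallel>\<close>, because the coordinates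
  \<open>\<beta>\<^sub>m (cnj w)\<^sup>m P(w)\<^sup>*\<eta>\<close> embed the kernel functions isometrically into \<open>\<ell>\<^sup>2(\<nat>, \<E>)\<close>.
  If \<open>\<beta>\<close> is bounded below, then \<open>z\<^sup>n P(z)\<xi>\<close> is therefore a bounded orbit of \<open>M\<^sub>z\<close>; its
  starting point \<open>P\<xi>\<close> is non-zero, so every orbit of \<open>M\<^sub>z\<^sup>*\<close> is bounded in the direction of
  \<open>P\<xi>\<close> and none is dense.

  Conversely, \<open>M\<^sub>z\<^sup>*\<close> shifts the Taylor coefficients at 0 of \<open>cnj w \<mapsto> K\<^sub>P(\<cdot>, w)\<eta>\<close> backwards.
  They span a dense subspace, and the norm of the \<open>n\<close>-th one is controlled by
  \<open>\<beta>\<^sub>n, \<dots>, \<beta>\<^sub>n\<^sub>-\<^sub>d\<close>. Since the ratios of consecutive weights are bounded, \<open>\<beta>\<close> is small on long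
  windows as soon as \<open>lim inf \<beta> = 0\<close>, and a Baire category argument gives a dense orbit. The same
  windows give the equivalence with the condition on the kernel, since
  \<open>\<partial>\<^sup>2\<^sup>nK\<^sub>P(0, 0) / (n!)\<^sup>2\<close> is the sum of \<open>\<beta>\<^sub>n\<^sub>-\<^sub>j\<^sup>2 A\<^sub>j A\<^sub>j\<^sup>*\<close> over \<open>j \<le> min n d\<close>.
\<close>

section \<open>Complex inner products and the Riesz representation\<close>

lemma cinner_add_right: "cinner x (y + z) = cinner x y + cinner x z"
  for x :: "'a::complex_hilbert"
  by (metis cinner_add_left cinner_commute complex_cnj_add)

lemma cinner_eq_Complex: "cinner x y = Complex (inner x y) (inner x (\<i> *\<^sub>C y))"
  for x :: "'a::complex_hilbert"
  by (rule complex_eqI) (simp_all add: Re_cinner[symmetric] cinner_scaleC_right)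

lemma bounded_linear_cinner_left: "bounded_linear (\<lambda>x::'a::complex_hilbert. cinner x y)"
  unfolding cinner_eq_Complex Complex_eq
  by (intro bounded_linear_add bounded_linear_const_mult
        bounded_linear_compose[OF bounded_linear_of_real] bounded_linear_inner_left)

lemma scaleC_zero_right [simp]: "c *\<^sub>C (0::'a::complex_hilbert) = 0"
  by (rule linear_simps(3)[OF bounded_linear_scaleC])

lemma scaleC_zero_left [simp]: "0 *\<^sub>C (x::'a::complex_hilbert) = 0"
  using scaleC_of_real[of 0 x] by simp

lemma scaleC_one [simp]: "1 *\<^sub>C (x::'a::complex_hilbert) = x"
  using scaleC_of_real[of 1 x] by simp

lemma scaleC_scaleR: "c *\<^sub>C (r *\<^sub>R x) = r *\<^sub>R (c *\<^sub>C (x::'a::complex_hilbert))"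
  by (rule linear_simps(5)[OF bounded_linear_scaleC])

lemma scaleC_left_commute: "c *\<^sub>C (b *\<^sub>C x) = b *\<^sub>C (c *\<^sub>C (x::'a::complex_hilbert))"
  by (simp add: scaleC_scaleC mult.commute)

lemma scaleC_sum_right: "c *\<^sub>C (\<Sum>i\<in>I. f i) = (\<Sum>i\<in>I. c *\<^sub>C (f i :: 'a::complex_hilbert))"
  by (rule linear_sum) (rule bounded_linear.linear[OF bounded_linear_scaleC])

lemma cinner_sum_left: "cinner (\<Sum>i\<in>I. f i) x = (\<Sum>i\<in>I. cinner (f i :: 'a::complex_hilbert) x)"
  by (rule linear_sum) (rule bounded_linear.linear[OF bounded_linear_cinner_left])

lemma cinner_zero_left [simp]: "cinner 0 (x::'a::complex_hilbert) = 0"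
  by (rule linear_simps(3)[OF bounded_linear_cinner_left])

lemma cinner_zero_right [simp]: "cinner (x::'a::complex_hilbert) 0 = 0"
  using cinner_commute[of x 0] by simp

lemma cinner_ext: "(\<And>x. cinner x a = cinner x b) \<Longrightarrow> a = (b::'a::complex_hilbert)"
  by (metis Re_cinner inner_commute vector_eq_rdot)

lemma cinner_ext_left: "(\<And>x. cinner a x = cinner b x) \<Longrightarrow> a = (b::'a::complex_hilbert)"
  by (rule cinner_ext) (metis cinner_commute)

text \<open>
  \<open>R\<close> is a bounded functional given by its graph on a subspace that need be neither closed nor
  dense; \<open>h\<close> is the limit of a sequence minimising \<open>\<parallel>x\<parallel>\<^sup>2 - 2r\<close> over \<open>R\<close>.
\<close>

lemma riesz_relation:
  fixes R :: "('a::{real_inner,banach} \<times> real) set"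
  assumes R: "subspace R" and bound: "\<And>x r. (x, r) \<in> R \<Longrightarrow> \<bar>r\<bar> \<le> C * norm x" and "0 \<le> C"
  obtains h where "\<And>x r. (x, r) \<in> R \<Longrightarrow> inner x h = r" "norm h \<le> C"
proof -
  define J where "J p = (norm (fst p))\<^sup>2 - 2 * snd p" for p :: "'a \<times> real"
  define \<mu> where "\<mu> = Inf (J ` R)"
  \<comment> \<open>Completing the square: \<open>J p\<close> is at least
    \<open>(norm (fst p) - C)\<^sup>2 - C\<^sup>2\<close>.\<close>
  have low: "- C\<^sup>2 \<le> J p" if "p \<in> R" for p
  proof -
    have "2 * snd p \<le> 2 * (C * norm (fst p))"
      using bound[of "fst p" "snd p"] that by auto
    moreover have "0 \<le> (norm (fst p) - C)\<^sup>2" by simp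
    ultimately show ?thesis
      by (simp add: J_def power2_diff algebra_simps)
  qed
  have bdd: "bdd_below (J ` R)"
    using low by (intro bdd_belowI2[where m = "- C\<^sup>2"]) blast
  have mu_le: "\<mu> \<le> J p" if "p \<in> R" for p
    unfolding \<mu>_def using bdd that by (simp add: cINF_lower)
  have "\<exists>p\<in>R. J p < \<mu> + 1 / Suc n" for n
    unfolding \<mu>_def using cINF_less_iff[OF _ bdd, of "\<mu> + 1 / Suc n"] subspace_0[OF R]
    by (metis \<mu>_def empty_iff less_add_same_cancel1 of_nat_0_less_iff zero_less_Suc zero_less_divide_1_iff)
  then obtain p where p: "\<And>n. p n \<in> R" "\<And>n. J (p n) < \<mu> + 1 / Suc n"
    by metis
  define x where "x n = fst (p n)" for n
  \<comment> \<open>The midpoint of \<open>p m\<close> and \<open>p n\<close> lies in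
    \<open>R\<close>, so its \<open>J\<close>-value is at least \<open>\<mu>\<close>; the
    parallelogram law turns this into a bound on the distance.\<close>
  have cauchy_bound: "(norm (x m - x n))\<^sup>2 \<le> 2 / Suc m + 2 / Suc n" for m n
  proof -
    have "(1/2) *\<^sub>R (p m + p n) \<in> R"
      by (intro subspace_scale subspace_add R p)
    then have "\<mu> \<le> (norm (x m + x n))\<^sup>2 / 4 - (snd (p m) + snd (p n))"
      using mu_le[of "(1/2) *\<^sub>R (p m + p n)"] by (simp add: J_def x_def power_divide add_divide_distrib)
    moreover have "(norm (x m + x n))\<^sup>2 + (norm (x m - x n))\<^sup>2 = 2 * (norm (x m))\<^sup>2 + 2 * (norm (x n))\<^sup>2"
      by (simp add: power2_norm_eq_inner inner_add inner_diff inner_commute)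
    ultimately show ?thesis
      using p(2)[of m] p(2)[of n] by (simp add: J_def x_def)
  qed
  have "Cauchy x"
  proof (rule metric_CauchyI)
    fix e :: real assume "e > 0"
    then obtain N where N: "1 / Suc N < e\<^sup>2 / 4"
      using nat_approx_posE[of "e\<^sup>2 / 4"] by (metis divide_pos_pos zero_less_numeral zero_less_power)
    have "dist (x m) (x n) < e" if "m \<ge> N" "n \<ge> N" for m n
    proof -
      have "1 / Suc m \<le> 1 / Suc N" "1 / Suc n \<le> 1 / Suc N"
        using that by (simp_all add: frac_le)
      then have "(norm (x m - x n))\<^sup>2 < e\<^sup>2"
        using N cauchy_bound[of m n] by simp
      then show ?thesis
        using \<open>e > 0\<close> by (simp add: dist_norm power_less_imp_less_base)
    qed
    then show "\<exists>N. \<forall>m\<ge>N. \<forall>n\<ge>N. dist (x m) (x n) < e" by blast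
  qed
  then obtain h where h: "x \<longlonglongrightarrow> h"
    using Cauchy_convergent convergent_def by blast
  have inner_h: "inner y h = s" if ys: "(y, s) \<in> R" for y s
  proof -
    \<comment> \<open>The limit \<open>h\<close> need not lie in the domain of \<open>R\<close>, so
      the variation in direction \<open>(y, s)\<close> is taken along the minimising sequence; its
      error \<open>1 / Suc n\<close> disappears in the limit.\<close>
    have quad: "0 \<le> 2 * t * (inner h y - s) + t\<^sup>2 * (norm y)\<^sup>2" for t
    proof (rule LIMSEQ_le)
      show "(\<lambda>n. 0) \<longlonglongrightarrow> (0::real)" by simp
      have "(\<lambda>n. 1 / real (Suc n)) \<longlonglongrightarrow> 0"
        using LIMSEQ_inverse_real_of_nat by (simp add: inverse_eq_divide)
      then have "(\<lambda>n. 1 / real (Suc n) + 2 * t * (inner (x n) y - s) + t\<^sup>2 * (norm y)\<^sup>2)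
          \<longlonglongrightarrow> 0 + 2 * t * (inner h y - s) + t\<^sup>2 * (norm y)\<^sup>2"
        by (intro tendsto_add tendsto_mult tendsto_diff tendsto_inner tendsto_const h)
      then show "(\<lambda>n. 1 / Suc n + 2 * t * (inner (x n) y - s) + t\<^sup>2 * (norm y)\<^sup>2)
          \<longlonglongrightarrow> 2 * t * (inner h y - s) + t\<^sup>2 * (norm y)\<^sup>2"
        by simp
      have "0 \<le> 1 / Suc n + 2 * t * (inner (x n) y - s) + t\<^sup>2 * (norm y)\<^sup>2" for n
      proof -
        have "p n + t *\<^sub>R (y, s) \<in> R"
          by (intro subspace_scale subspace_add R p ys)
        moreover have "(norm (x n + t *\<^sub>R y))\<^sup>2 = (norm (x n))\<^sup>2 + 2 * t * inner (x n) y + t\<^sup>2 * (norm y)\<^sup>2"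
          unfolding power2_norm_eq_inner by (simp add: inner_add inner_commute power2_eq_square)
        ultimately show ?thesis
          using mu_le[of "p n + t *\<^sub>R (y, s)"] p(2)[of n] by (simp add: J_def x_def right_diff_distrib)
      qed
      then show "\<exists>N. \<forall>n\<ge>N. 0 \<le> 1 / Suc n + 2 * t * (inner (x n) y - s) + t\<^sup>2 * (norm y)\<^sup>2"
        by blast
    qed
    define a where "a = inner h y - s"
    have "a = 0"
    proof (rule ccontr)
      assume "a \<noteq> 0"
      \<comment> \<open>At \<open>t = - a / b\<close> the quadratic would be negative; the summand 1
        keeps \<open>b\<close> positive even for \<open>y = 0\<close>.\<close>
      define b where "b = 1 + (norm y)\<^sup>2"
      have "b > 0" by (simp add: b_def add_pos_nonneg)
      have "0 \<le> 2 * (- a / b) * a + (- a / b)\<^sup>2 * (norm y)\<^sup>2"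
        using quad[of "- a / b"] by (simp add: a_def)
      also have "\<dots> \<le> 2 * (- a / b) * a + (- a / b)\<^sup>2 * b"
        by (intro add_left_mono mult_left_mono) (auto simp: b_def)
      also have "\<dots> = - a\<^sup>2 / b"
        using \<open>b > 0\<close> by (simp add: power2_eq_square field_simps)
      also have "\<dots> < 0"
        using \<open>b > 0\<close> \<open>a \<noteq> 0\<close> by simp
      finally show False by simp
    qed
    then show ?thesis by (simp add: a_def inner_commute)
  qed
  \<comment> \<open>As a limit of points of the domain, \<open>h\<close> inherits the bound from the
    \<open>x n\<close>.\<close>
  have "(norm h)\<^sup>2 \<le> C * norm h"
  proof (rule LIMSEQ_le)
    show "(\<lambda>n. inner (x n) h) \<longlonglongrightarrow> (norm h)\<^sup>2"
      by (auto intro!: tendsto_eq_intros h simp: power2_norm_eq_inner)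
    show "(\<lambda>n. C * norm (x n)) \<longlonglongrightarrow> C * norm h"
      by (intro tendsto_intros h)
    have "inner (x n) h \<le> C * norm (x n)" for n
      using inner_h[of "x n" "snd (p n)"] bound[of "x n" "snd (p n)"] p(1)[of n] by (simp add: x_def)
    then show "\<exists>N. \<forall>n\<ge>N. inner (x n) h \<le> C * norm (x n)" by blast
  qed
  then have "norm h \<le> C"
    using \<open>0 \<le> C\<close> by (cases "h = 0") (simp_all add: power2_eq_square)
  with inner_h show thesis by (rule that)
qed

lemma subspace_closure:
  fixes S :: "'a::real_normed_vector set"
  assumes "subspace S"
  shows "subspace (closure S)"
  unfolding subspace_def
proof (intro conjI ballI allI)
  show "0 \<in> closure S"
    using subspace_0[OF assms] closure_subset by blast
  show "x + y \<in> closure S" if xy: "x \<in> closure S" "y \<in> closure S" for x y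
  proof -
    obtain a b where "\<And>n. a n \<in> S" "a \<longlonglongrightarrow> x" "\<And>n. b n \<in> S" "b \<longlonglongrightarrow> y"
      using xy unfolding closure_sequential by auto
    then have "(\<lambda>n. a n + b n) \<longlonglongrightarrow> x + y" "\<And>n. a n + b n \<in> S"
      by (auto intro: tendsto_add subspace_add assms)
    then show ?thesis
      unfolding closure_sequential by (intro exI[of _ "\<lambda>n. a n + b n"]) blast
  qed
  show "c *\<^sub>R x \<in> closure S" if x: "x \<in> closure S" for c x
  proof -
    obtain a where "\<And>n. a n \<in> S" "a \<longlonglongrightarrow> x"
      using x unfolding closure_sequential by auto
    then have "(\<lambda>n. c *\<^sub>R a n) \<longlonglongrightarrow> c *\<^sub>R x" "\<And>n. c *\<^sub>R a n \<in> S"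
      by (auto intro: tendsto_scaleR subspace_scale assms)
    then show ?thesis
      unfolding closure_sequential by (intro exI[of _ "\<lambda>n. c *\<^sub>R a n"]) blast
  qed
qed

section \<open>Adjoints\<close>

text \<open>For each \<open>y\<close> the graph of \<open>\<lambda>x. inner (T x) y\<close> is
  passed to \<open>riesz_relation\<close>; uniqueness of representing vectors makes the chosen
  \<open>S\<close> linear.\<close>

lemma real_adjoint_exists:
  fixes T :: "'a::{real_inner,banach} \<Rightarrow>\<^sub>L 'b::real_inner"
  obtains S where "\<And>x y. inner (blinfun_apply T x) y = inner x (blinfun_apply S y)"
proof -
  have "\<exists>h. (\<forall>x. inner x h = inner (T x) y) \<and> norm h \<le> norm T * norm y" for y
  proof -
    let ?R = "range (\<lambda>x. (x, inner (T x) y))"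
    have "linear (\<lambda>x. (x, inner (T x) y))"
      by (rule linearI) (simp_all add: blinfun.add_right blinfun.scaleR_right inner_add_left)
    then have "subspace ?R"
      by (rule linear_subspace_image) simp
    moreover have "\<bar>r\<bar> \<le> norm T * norm y * norm x" if "(x, r) \<in> ?R" for x r
    proof -
      have "\<bar>r\<bar> \<le> norm (T x) * norm y"
        using that Cauchy_Schwarz_ineq2 by auto
      also have "\<dots> \<le> norm T * norm x * norm y"
        by (intro mult_right_mono norm_blinfun) simp
      finally show ?thesis by (simp add: mult_ac)
    qed
    ultimately obtain h where "\<And>x r. (x, r) \<in> ?R \<Longrightarrow> inner x h = r"
        "norm h \<le> norm T * norm y"
      using riesz_relation[of ?R "norm T * norm y", OF _ _ mult_nonneg_nonneg[OF norm_ge_zero norm_ge_zero]] by blast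
    then show ?thesis
      by blast
  qed
  then obtain S where S: "\<And>x y. inner x (S y) = inner (T x) y" "\<And>y. norm (S y) \<le> norm T * norm y"
    by metis
  have "bounded_linear S"
  proof (rule bounded_linear_intro)
    fix y z :: 'b and r :: real
    have "inner x (S (y + z)) = inner x (S y + S z)" for x
      by (simp add: S inner_add_right)
    then show "S (y + z) = S y + S z"
      by (metis inner_commute vector_eq_rdot)
    have "inner x (S (r *\<^sub>R y)) = inner x (r *\<^sub>R S y)" for x
      by (simp add: S)
    then show "S (r *\<^sub>R y) = r *\<^sub>R S y"
      by (metis inner_commute vector_eq_rdot)
    show "norm (S y) \<le> norm y * norm T"
      by (metis S(2) mult.commute)
  qed
  then show thesis
    using S by (intro that[of "Blinfun S"]) (simp add: bounded_linear_Blinfun_apply)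
qed

lemma cadjoint_eqI:
  assumes "\<And>x y. cinner (blinfun_apply T x) y = cinner x (blinfun_apply S y)"
  shows "cadjoint T = S"
  unfolding cadjoint_def
proof (rule the_equality)
  fix S' assume "\<forall>x y. cinner (blinfun_apply T x) y = cinner x (blinfun_apply S' y)"
  then have "cinner x (blinfun_apply S' y) = cinner x (blinfun_apply S y)" for x y
    using assms[of x y] by simp
  then show "S' = S"
    by (blast intro: blinfun_eqI cinner_ext)
qed (use assms in blast)

text \<open>The real adjoint already is the complex one: \<open>T\<close> commutes with
  multiplication by \<open>\<i>\<close>, and the imaginary part of \<open>cinner u v\<close> is
  \<open>- inner (\<i> *\<^sub>C u) v\<close>.\<close>

lemma cinner_cadjoint:
  assumes T: "complex_linear T"
  shows "cinner (blinfun_apply T x) y = cinner x (blinfun_apply (cadjoint T) y)"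
proof -
  obtain S where S: "\<And>x y. inner (blinfun_apply T x) y = inner x (blinfun_apply S y)"
    using real_adjoint_exists[of T] by blast
  have "cinner (blinfun_apply T x) y = cinner x (blinfun_apply S y)" for x y
  proof (rule complex_eqI)
    show "Re (cinner (blinfun_apply T x) y) = Re (cinner x (blinfun_apply S y))"
      by (simp add: Re_cinner S)
    have Im: "Im (cinner u v) = - inner (\<i> *\<^sub>C u) v" for u v :: "'c::complex_hilbert"
      by (simp add: Re_cinner[symmetric] cinner_scaleC_left)
    show "Im (cinner (blinfun_apply T x) y) = Im (cinner x (blinfun_apply S y))"
      using T unfolding Im complex_linear_def by (metis S)
  qed
  then show ?thesis
    using cadjoint_eqI by metis
qed

lemma complex_linear_cadjoint:
  assumes "complex_linear T"
  shows "complex_linear (cadjoint T)"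
  unfolding complex_linear_def
proof (intro allI)
  fix c x
  show "blinfun_apply (cadjoint T) (c *\<^sub>C x) = c *\<^sub>C blinfun_apply (cadjoint T) x"
    by (rule cinner_ext) (simp add: cinner_cadjoint[OF assms, symmetric] cinner_scaleC_right)
qed

section \<open>Backward shifts\<close>

text \<open>One half of Birkhoff's transitivity theorem. The points whose orbit enters a given ball
  form an open dense set, and Baire's theorem yields a point common to the countably many sets with
  centre in \<open>D\<close> and radius \<open>1 / Suc n\<close>.\<close>

lemma hypercyclic_if_transitive:
  fixes T :: "'a::banach \<Rightarrow>\<^sub>L 'a" and D :: "'a set"
  assumes "countable D" "closure D = UNIV"
    and trans: "\<And>U V. open U \<Longrightarrow> open V \<Longrightarrow> U \<noteq> {} \<Longrightarrow> V \<noteq> {}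
      \<Longrightarrow> \<exists>x\<in>U. \<exists>m. (blinfun_apply T ^^ m) x \<in> V"
  shows "hypercyclic T"
proof -
  define G where "G y n = (\<Union>m. (blinfun_apply T ^^ m) -` ball y (1 / Suc n))" for y and n :: nat
  have cont: "continuous_on UNIV (blinfun_apply T ^^ m)" for m
    by (induction m) (auto intro!: continuous_intros simp: o_def id_def)
  have "open (G y n)" for y n
    unfolding G_def by (intro open_UN ballI open_vimage cont) simp
  moreover have "closure (G y n) = UNIV" for y n
  proof -
    have "\<exists>x\<in>U. x \<in> G y n" if "open U" "U \<noteq> {}" for U
      using trans[OF that(1), of "ball y (1 / Suc n)"] that(2) by (auto simp: G_def)
    \<comment> \<open>The complement of the closure is open and misses \<open>G y n\<close>, hence
      is empty.\<close>
    from this[of "- closure (G y n)"] show ?thesis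
      using closure_subset[of "G y n"] by auto
  qed
  ultimately have "(euclidean closure_of \<Inter>((\<lambda>(y, n). G y n) ` (D \<times> UNIV))) = topspace (euclidean :: 'a topology)"
    using \<open>countable D\<close>
    by (intro Baire_category disjI1 completely_metrizable_space_euclidean)
       (auto simp: open_openin[symmetric])
  then have "\<Inter>((\<lambda>(y, n). G y n) ` (D \<times> UNIV)) \<noteq> {}"
    by (metis UNIV_not_empty closure_empty closure_of_empty topspace_euclidean)
  then obtain x where x: "\<And>y n. y \<in> D \<Longrightarrow> x \<in> G y n"
    by blast
  have "D \<subseteq> closure (range (\<lambda>m. (blinfun_apply T ^^ m) x))"
  proof
    fix y assume "y \<in> D"
    show "y \<in> closure (range (\<lambda>m. (blinfun_apply T ^^ m) x))"
      unfolding closure_approachable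
    proof (intro allI impI)
      fix e :: real assume "e > 0"
      then obtain n where "1 / Suc n < e" by (rule nat_approx_posE)
      moreover obtain m where "dist y ((blinfun_apply T ^^ m) x) < 1 / Suc n"
        using x[OF \<open>y \<in> D\<close>, of n] by (auto simp: G_def)
      ultimately show "\<exists>z\<in>range (\<lambda>m. (blinfun_apply T ^^ m) x). dist z y < e"
        by (auto simp: dist_commute intro!: exI[of _ m])
    qed
  qed
  then have "closure (range (\<lambda>m. (blinfun_apply T ^^ m) x)) = UNIV"
    using \<open>closure D = UNIV\<close> by (metis closed_closure closure_minimal top.extremum_uniqueI)
  then show ?thesis
    unfolding hypercyclic_def by blast
qed

text \<open>A form of the hypercyclicity criterion. Raising all indices by \<open>m\<close> is
  undone by \<open>m\<close> applications of \<open>T\<close>, raising by \<open>r k\<close> makes a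
  combination small, and high powers of \<open>T\<close> kill any fixed one; so
  \<open>X ps + X (S (r k) qs)\<close> starts near \<open>X ps\<close> and lands on
  \<open>X qs\<close>.\<close>

lemma hypercyclic_backward_shift:
  fixes T :: "'a::banach \<Rightarrow>\<^sub>L 'a" and e :: "nat \<Rightarrow> 'e::real_normed_vector \<Rightarrow> 'a" and E :: "'e set"
  assumes "countable E" "closure E = UNIV"
    and lin: "\<And>n. bounded_linear (e n)"
    and T0: "\<And>x. blinfun_apply T (e 0 x) = 0"
    and TSuc: "\<And>n x. blinfun_apply T (e (Suc n) x) = e n x"
    and dense: "closure (span (\<Union>n. range (e n))) = UNIV"
    and small: "\<And>n x. (\<lambda>k. e (n + r k) x) \<longlonglongrightarrow> 0"
    and r: "filterlim r at_top sequentially"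
  shows "hypercyclic T"
proof -
  \<comment> \<open>Combinations are coded by lists because \<open>X\<close> need not be injective:
    raising indices is well defined on lists but perhaps not on vectors.\<close>
  define X where "X ps = sum_list (map (case_prod e) ps)" for ps
  define S where "S m ps = map (apfst (\<lambda>n. n + m)) ps" for m :: nat and ps :: "(nat \<times> 'e) list"
  have X_simps [simp]: "X [] = 0" "X (p # ps) = e (fst p) (snd p) + X ps" for p ps
    by (simp_all add: X_def case_prod_unfold)
  have X_append: "X (ps @ qs) = X ps + X qs" for ps qs
    by (simp add: X_def)
  have X_scale: "X (map (apsnd (\<lambda>x. c *\<^sub>R x)) ps) = c *\<^sub>R X ps" for c ps
    by (induction ps) (simp_all add: linear_simps(5)[OF lin] scaleR_add_right)
  have "subspace (range X)"
    unfolding subspace_def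
  proof (intro conjI ballI allI)
    show "0 \<in> range X" using X_simps(1) by (metis rangeI)
    show "x + y \<in> range X" if "x \<in> range X" "y \<in> range X" for x y
      using that by (auto simp flip: X_append)
    show "c *\<^sub>R x \<in> range X" if "x \<in> range X" for c x
      using that by (auto simp flip: X_scale)
  qed
  moreover have "(\<Union>n. range (e n)) \<subseteq> range X"
  proof clarify
    fix n x show "e n x \<in> range X"
      using rangeI[of X "[(n, x)]"] by simp
  qed
  ultimately have "span (\<Union>n. range (e n)) \<subseteq> range X"
    by (rule span_minimal[rotated])
  then have X_dense: "closure (range X) = UNIV"
    using dense closure_mono by blast
  have pow0: "(blinfun_apply T ^^ m) 0 = 0" for m
    by (induction m) auto
  have pow_add: "(blinfun_apply T ^^ m) (x + y) = (blinfun_apply T ^^ m) x + (blinfun_apply T ^^ m) y" for m x y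
    by (induction m) (auto simp: blinfun.add_right)
  have pow_shift: "(blinfun_apply T ^^ m) (e (n + m) x) = e n x" for m n x
    by (induction m) (simp_all add: funpow_swap1 TSuc)
  have T_S: "(blinfun_apply T ^^ m) (X (S m ps)) = X ps" for m ps
    by (induction ps) (simp_all add: S_def pow0 pow_add pow_shift)
  have vanish: "(blinfun_apply T ^^ m) (X ps) = 0" if "\<And>p. p \<in> set ps \<Longrightarrow> fst p < m" for m ps
    using that
  proof (induction ps)
    case (Cons p ps)
    \<comment> \<open>After \<open>fst p\<close> applications the term has index 0 and one more
      annihilates it; the remaining \<open>j\<close> act on 0.\<close>
    then obtain j where j: "m = Suc (fst p) + j"
      by (metis less_iff_Suc_add list.set_intros(1) add_Suc)
    have "(blinfun_apply T ^^ Suc (fst p)) (e (fst p) (snd p)) = 0"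
      using pow_shift[of "fst p" 0] by (simp add: T0)
    then have "(blinfun_apply T ^^ m) (e (fst p) (snd p)) = 0"
      unfolding j by (subst add.commute) (simp only: funpow_add o_apply pow0)
    with Cons show ?case by (simp add: pow_add)
  qed (simp add: pow0)
  have S_small: "(\<lambda>k. X (S (r k) ps)) \<longlonglongrightarrow> 0" for ps
  proof (induction ps)
    case (Cons p ps)
    show ?case
      using tendsto_add[OF small[of "fst p" "snd p"] Cons] by (simp add: S_def)
  qed (simp add: S_def)
  define D where "D = X ` lists (UNIV \<times> E)"
  have "countable D"
    unfolding D_def using \<open>countable E\<close> by (intro countable_image countable_lists countable_SIGMA) auto
  \<comment> \<open>Each \<open>e n\<close> is continuous, so coefficients can be replaced one at a
    time by nearby members of \<open>E\<close>.\<close>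
  have "X ps \<in> closure D" for ps
  proof (induction ps)
    case Nil
    show ?case using closure_subset[of D] by (auto simp: D_def intro!: image_eqI[of _ _ "[]"])
  next
    case (Cons p ps)
    show ?case
      unfolding closure_approachable
    proof (intro allI impI)
      fix \<epsilon> :: real assume "\<epsilon> > 0"
      have "isCont (e (fst p)) (snd p)"
        using linear_continuous_at[OF lin] .
      then obtain \<delta> where \<delta>: "\<delta> > 0" "\<And>x. dist x (snd p) < \<delta> \<Longrightarrow> dist (e (fst p) x) (e (fst p) (snd p)) < \<epsilon> / 2"
        using \<open>\<epsilon> > 0\<close> unfolding continuous_at_eps_delta by (metis half_gt_zero)
      obtain x where x: "x \<in> E" "dist x (snd p) < \<delta>"
        using \<open>closure E = UNIV\<close> \<delta>(1) closure_approachable[of "snd p" E] by auto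
      obtain qs where qs: "qs \<in> lists (UNIV \<times> E)" "dist (X qs) (X ps) < \<epsilon> / 2"
        using Cons[unfolded closure_approachable, rule_format, of "\<epsilon> / 2"] \<open>\<epsilon> > 0\<close>
        by (auto simp: D_def)
      have "dist (X ((fst p, x) # qs)) (X (p # ps)) < \<epsilon>"
        using \<delta>(2)[OF x(2)] qs(2) dist_triangle_add[of "e (fst p) x" "X qs" "e (fst p) (snd p)" "X ps"] by simp
      moreover have "X ((fst p, x) # qs) \<in> D"
        unfolding D_def using x(1) qs(1) by (intro imageI) simp
      ultimately show "\<exists>y\<in>D. dist y (X (p # ps)) < \<epsilon>" by blast
    qed
  qed
  then have "closure D = UNIV"
    using X_dense by (metis closed_closure closure_minimal image_subsetI top.extremum_uniqueI)
  show ?thesis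
  proof (rule hypercyclic_if_transitive[OF \<open>countable D\<close> \<open>closure D = UNIV\<close>])
    fix U V :: "'a set" assume UV: "open U" "open V" "U \<noteq> {}" "V \<noteq> {}"
    obtain ps where ps: "X ps \<in> U"
      using X_dense UV open_Int_closure_eq_empty[of U "range X"] by auto
    obtain qs where qs: "X qs \<in> V"
      using X_dense UV open_Int_closure_eq_empty[of V "range X"] by auto
    have "(\<lambda>k. X ps + X (S (r k) qs)) \<longlonglongrightarrow> X ps + 0"
      by (intro tendsto_intros S_small)
    then have "eventually (\<lambda>k. X ps + X (S (r k) qs) \<in> U) sequentially"
      using topological_tendstoD[OF _ UV(1)] ps by fastforce
    \<comment> \<open>\<open>insert 0\<close> covers the empty list, where \<open>Max\<close> would
      have no specified value.\<close>
    moreover have "eventually (\<lambda>k. Max (insert 0 (fst ` set ps)) < r k) sequentially"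
      using r unfolding filterlim_at_top Suc_le_eq[symmetric] by blast
    ultimately have "eventually (\<lambda>k. X ps + X (S (r k) qs) \<in> U \<and> Max (insert 0 (fst ` set ps)) < r k) sequentially"
      by (rule eventually_conj)
    then obtain k where k: "X ps + X (S (r k) qs) \<in> U" "Max (insert 0 (fst ` set ps)) < r k"
      using eventually_happens'[OF sequentially_bot] by blast
    have "(blinfun_apply T ^^ r k) (X ps + X (S (r k) qs)) = X qs"
      using k(2) by (simp add: pow_add T_S vanish)
    with qs k(1) show "\<exists>x\<in>U. \<exists>m. (blinfun_apply T ^^ m) x \<in> V"
      by (metis)
  qed
qed

section \<open>Power series on the disc\<close>

lemma summable_diffs_disc:
  fixes a :: "nat \<Rightarrow> complex"
  assumes "\<And>z. z \<in> disc \<Longrightarrow> summable (\<lambda>n. a n * z ^ n)" "z \<in> disc"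
  shows "summable (\<lambda>n. diffs a n * z ^ n)"
  using assms termdiff_converges[of z 1 a] by simp

text \<open>The induction needs all indices: the \<open>n\<close>-th coefficient of the
  \<open>m\<close>-fold formal derivative is \<open>(n + 1) ... (n + m) * a (n + m)\<close>.\<close>

lemma diffs_funpow_0: "(diffs ^^ m) a 0 = fact m * (a m :: complex)"
proof -
  have "(diffs ^^ m) a n = (\<Prod>i=1..m. of_nat (n + i)) * a (n + m)" for n
  proof (induction m arbitrary: n)
    case (Suc m)
    have "(diffs ^^ Suc m) a n = of_nat (Suc n) * ((\<Prod>i=1..m. of_nat (Suc n + i)) * a (Suc n + m))"
      by (simp add: diffs_def Suc)
    moreover have "(\<Prod>i=1..Suc m. of_nat (n + i) :: complex) = of_nat (Suc n) * (\<Prod>i=1..m. of_nat (Suc n + i))"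
      by (subst prod.atLeast_Suc_atMost) (simp_all add: prod.atLeast_Suc_atMost_Suc_shift add.left_commute del: prod.cl_ivl_Suc)
    ultimately show ?case by simp
  qed simp
  from this[of 0] show ?thesis
    by (simp add: fact_prod)
qed

text \<open>The zero function is differentiated \<open>m\<close> times term by term and evaluated at
  0.\<close>

lemma power_series_zero_coeff:
  fixes a :: "nat \<Rightarrow> complex"
  assumes a: "\<And>z. z \<in> disc \<Longrightarrow> (\<lambda>n. a n * z ^ n) sums 0"
  shows "a m = 0"
proof -
  have "(\<lambda>n. (diffs ^^ m) a n * z ^ n) sums 0" if "z \<in> disc" for z
    using that
  proof (induction m arbitrary: z)
    case (Suc m)
    show ?case
      unfolding funpow.simps o_apply
    proof (rule termdiffs_sums_strong[where K = 1 and f = "\<lambda>_. 0"])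
      show "(\<lambda>n. (diffs ^^ m) a n * w ^ n) sums 0" if "norm w < 1" for w
        using Suc.IH that by simp
    qed (use Suc.prems in auto)
  qed (simp add: a)
  from this[of 0] have "(diffs ^^ m) a 0 = 0" by simp
  then show ?thesis by (simp add: diffs_funpow_0)
qed

text \<open>Delaying by \<open>i\<close> places is what multiplication by the \<open>i\<close>-th
  power of the variable does to coefficients. The guard excludes indices where \<open>n - i\<close>
  is truncated to 0.\<close>

lemma sums_shift_conv:
  fixes f :: "nat \<Rightarrow> 'a::real_normed_vector"
  shows "(\<lambda>n. if i \<le> n then f (n - i) else 0) sums s \<longleftrightarrow> f sums s"
  using sums_iff_shift[of "\<lambda>n. if i \<le> n then f (n - i) else 0" i s] by simp

section \<open>Weights of ratio at most one\<close>

text \<open>The form in which the limsup hypothesis is used, for summability and for comparing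
  nearby weights.\<close>

lemma ratio_bound:
  fixes \<beta> :: "nat \<Rightarrow> real"
  assumes pos: "\<And>n. \<beta> n > 0" and ratio: "limsup (\<lambda>n. ereal (\<beta> (Suc n) / \<beta> n)) \<le> 1" and "c > 1"
  shows "eventually (\<lambda>n. \<beta> (Suc n) \<le> c * \<beta> n) sequentially"
proof -
  have "limsup (\<lambda>n. ereal (\<beta> (Suc n) / \<beta> n)) < ereal c"
    using ratio by (rule le_less_trans) (use \<open>c > 1\<close> in simp)
  from Limsup_lessD[OF this] show ?thesis
    by (rule eventually_mono) (use pos in \<open>simp add: divide_less_eq less_imp_le\<close>)
qed

lemma summable_weights:
  fixes \<beta> :: "nat \<Rightarrow> real"
  assumes pos: "\<And>n. \<beta> n > 0" and ratio: "limsup (\<lambda>n. ereal (\<beta> (Suc n) / \<beta> n)) \<le> 1"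
    and t: "0 \<le> t" "t < 1"
  shows "summable (\<lambda>n. \<beta> n * t ^ n)"
proof -
  obtain c where c: "1 < c" "c * t < 1"
  proof (cases "t = 0")
    case False
    then have "1 < 1 / t" using t by simp
    then obtain c where "1 < c" "c < 1 / t" using dense by blast
    then show ?thesis using that[of c] t False by (simp add: field_simps)
  qed (use that[of 2] in simp)
  obtain N where N: "\<And>n. n \<ge> N \<Longrightarrow> \<beta> (Suc n) \<le> c * \<beta> n"
    using ratio_bound[OF pos ratio c(1)] by (auto simp: eventually_sequentially)
  show ?thesis
  proof (rule summable_ratio_test[OF c(2)])
    show "norm (\<beta> (Suc n) * t ^ Suc n) \<le> c * t * norm (\<beta> n * t ^ n)" if "n \<ge> N" for n
    proof -
      have "\<beta> (Suc n) * t ^ Suc n \<le> c * \<beta> n * t ^ Suc n"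
        using N[OF that] t by (intro mult_right_mono) auto
      then show ?thesis using pos t c by (simp add: abs_mult less_imp_le mult_ac)
    qed
  qed
qed

text \<open>With \<open>s = sqrt (cmod z)\<close> the terms have modulus
  \<open>(\<beta> n * s ^ n)\<^sup>2\<close>, eventually dominated by the summable
  \<open>\<beta> n * s ^ n\<close>.\<close>

lemma summable_weights_power2:
  fixes \<beta> :: "nat \<Rightarrow> real"
  assumes pos: "\<And>n. \<beta> n > 0" and ratio: "limsup (\<lambda>n. ereal (\<beta> (Suc n) / \<beta> n)) \<le> 1"
    and "z \<in> disc"
  shows "summable (\<lambda>n. complex_of_real ((\<beta> n)\<^sup>2) * z ^ n)"
proof (rule summable_norm_cancel)
  define s where "s = sqrt (cmod z)"
  have s: "0 \<le> s" "s < 1" "s * s = cmod z"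
    using \<open>z \<in> disc\<close> by (simp_all add: s_def)
  have sm: "summable (\<lambda>n. \<beta> n * s ^ n)"
    by (rule summable_weights[OF pos ratio s(1,2)])
  have "eventually (\<lambda>n. norm (\<beta> n * s ^ n) < 1) sequentially"
    using order_tendstoD(2)[OF tendsto_norm[OF summable_LIMSEQ_zero[OF sm]]] by simp
  then show "summable (\<lambda>n. norm (complex_of_real ((\<beta> n)\<^sup>2) * z ^ n))"
  proof (rule summable_comparison_test_ev[rotated, OF sm eventually_mono])
    fix n assume "norm (\<beta> n * s ^ n) < 1"
    then have "(\<beta> n * s ^ n) * (\<beta> n * s ^ n) \<le> 1 * (\<beta> n * s ^ n)"
      using pos[of n] s(1) by (intro mult_right_mono) auto
    moreover have "norm (norm (complex_of_real ((\<beta> n)\<^sup>2) * z ^ n)) = (\<beta> n * s ^ n) * (\<beta> n * s ^ n)"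
      using pos[of n] by (simp add: norm_mult norm_power s(3)[symmetric] power_mult_distrib power2_eq_square)
    ultimately show "norm (norm (complex_of_real ((\<beta> n)\<^sup>2) * z ^ n)) \<le> \<beta> n * s ^ n"
      by simp
  qed
qed

text \<open>Eventually a weight at most doubles from one index to the next, so smallness survives
  any fixed number of steps forwards. To control \<open>d\<close> preceding weights as well, later
  arguments use the subsequence \<open>r k + d\<close>.\<close>

lemma weights_shift_tendsto_0:
  fixes \<beta> :: "nat \<Rightarrow> real"
  assumes pos: "\<And>n. \<beta> n > 0" and ratio: "limsup (\<lambda>n. ereal (\<beta> (Suc n) / \<beta> n)) \<le> 1"
    and r: "strict_mono r" and lim: "(\<lambda>k. \<beta> (r k)) \<longlonglongrightarrow> 0"
  shows "(\<lambda>k. \<beta> (r k + j)) \<longlonglongrightarrow> 0"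
proof (induction j)
  case (Suc j)
  show ?case
  proof (rule tendsto_sandwich[OF _ _ tendsto_const])
    show "eventually (\<lambda>k. 0 \<le> \<beta> (r k + Suc j)) sequentially"
      using pos by (simp add: less_imp_le)
    have "filterlim (\<lambda>k. r k + j) sequentially sequentially"
      by (rule filterlim_at_top_mono[OF filterlim_subseq[OF r]]) simp
    then have "eventually (\<lambda>k. \<beta> (Suc (r k + j)) \<le> 2 * \<beta> (r k + j)) sequentially"
      by (rule eventually_compose_filterlim[rotated]) (rule ratio_bound[OF pos ratio], simp)
    then show "eventually (\<lambda>k. \<beta> (r k + Suc j) \<le> 2 * \<beta> (r k + j)) sequentially"
      by simp
    show "(\<lambda>k. 2 * \<beta> (r k + j)) \<longlonglongrightarrow> 0"
      using tendsto_mult[OF tendsto_const Suc, of 2] by simp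
  qed
qed (simp add: lim)

lemma liminf_pos_eq_0_iff:
  fixes \<beta> :: "nat \<Rightarrow> real"
  assumes pos: "\<And>n. \<beta> n > 0"
  shows "liminf (\<lambda>n. ereal (\<beta> n)) = 0 \<longleftrightarrow> (\<exists>r. strict_mono r \<and> (\<lambda>k. \<beta> (r k)) \<longlonglongrightarrow> 0)"
proof
  assume "liminf (\<lambda>n. ereal (\<beta> n)) = 0"
  then obtain r where r: "strict_mono r" "((\<lambda>n. ereal (\<beta> n)) \<circ> r) \<longlonglongrightarrow> 0"
    using liminf_subseq_lim[of "\<lambda>n. ereal (\<beta> n)"] by auto
  then show "\<exists>r. strict_mono r \<and> (\<lambda>k. \<beta> (r k)) \<longlonglongrightarrow> 0"
    by (intro exI[of _ r]) (simp add: o_def zero_ereal_def)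
next
  assume "\<exists>r. strict_mono r \<and> (\<lambda>k. \<beta> (r k)) \<longlonglongrightarrow> 0"
  then obtain r where r: "strict_mono r" "(\<lambda>k. ereal (\<beta> (r k))) \<longlonglongrightarrow> 0"
    by (auto simp: zero_ereal_def)
  have "liminf (\<lambda>n. ereal (\<beta> n)) \<le> liminf (\<lambda>k. ereal (\<beta> (r k)))"
    using liminf_subseq_mono[OF r(1), of "\<lambda>n. ereal (\<beta> n)"] by (simp add: o_def)
  also have "\<dots> = 0"
    using lim_imp_Liminf[OF _ r(2)] by simp
  finally have "liminf (\<lambda>n. ereal (\<beta> n)) \<le> 0" .
  moreover have "0 \<le> liminf (\<lambda>n. ereal (\<beta> n))"
    by (rule Liminf_bounded) (use pos in \<open>simp add: less_imp_le\<close>)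
  ultimately show "liminf (\<lambda>n. ereal (\<beta> n)) = 0" by simp
qed

lemma weights_bounded_below:
  fixes \<beta> :: "nat \<Rightarrow> real"
  assumes pos: "\<And>n. \<beta> n > 0" and "liminf (\<lambda>n. ereal (\<beta> n)) \<noteq> 0"
  obtains c where "c > 0" "\<And>n. c \<le> \<beta> n"
proof -
  have "0 \<le> liminf (\<lambda>n. ereal (\<beta> n))"
    by (rule Liminf_bounded) (use pos in \<open>simp add: less_imp_le\<close>)
  then have "0 < liminf (\<lambda>n. ereal (\<beta> n))"
    using assms(2) by simp
  then obtain c where c: "0 < ereal c" "ereal c < liminf (\<lambda>n. ereal (\<beta> n))"
    using ereal_dense2 by blast
  from less_LiminfD[OF c(2)] obtain N where N: "\<And>n. n \<ge> N \<Longrightarrow> c < \<beta> n"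
    by (auto simp: eventually_sequentially)
  \<comment> \<open>The tail lies above \<open>c\<close>; the finitely many earlier weights are
    positive and join the minimum.\<close>
  define c' where "c' = Min (insert c (\<beta> ` {..<N}))"
  have "c' > 0"
    unfolding c'_def using c(1) pos by (subst Min_gr_iff) auto
  moreover have "c' \<le> \<beta> n" for n
  proof (cases "n < N")
    case True
    then show ?thesis unfolding c'_def by (intro Min_le) auto
  next
    case False
    have "c' \<le> c" unfolding c'_def by (intro Min_le) auto
    with N[of n] False show ?thesis by simp
  qed
  ultimately show thesis by (rule that)
qed

section \<open>The space of an operator polynomial\<close>

locale operator_poly_rkhs =
  fixes \<beta> :: "nat \<Rightarrow> real"
    and d :: nat
    and A :: "nat \<Rightarrow> 'e::complex_hilbert \<Rightarrow>\<^sub>L 'e"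
    and ev :: "'h::complex_hilbert \<Rightarrow> complex \<Rightarrow> 'e"
  assumes beta_pos: "\<And>n. \<beta> n > 0"
    and beta_ratio: "limsup (\<lambda>n. ereal (\<beta> (Suc n) / \<beta> n)) \<le> 1"
    and A_linear: "\<And>j. j \<le> d \<Longrightarrow> complex_linear (A j)"
    and H_P: "analytic_rkhs (K\<^sub>P \<beta> d A) ev"
begin

abbreviation P :: "complex \<Rightarrow> 'e \<Rightarrow>\<^sub>L 'e"
  where "P \<equiv> operator_poly d A"

abbreviation is_ker :: "complex \<Rightarrow> 'e \<Rightarrow> 'h \<Rightarrow> bool"
  where "is_ker \<equiv> is_kernel_function (K\<^sub>P \<beta> d A) ev"

lemma P_apply: "blinfun_apply (P z) x = (\<Sum>j\<le>d. z ^ j *\<^sub>C blinfun_apply (A j) x)"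
  by (simp add: operator_poly_def blinfun.sum_left scaleC_blinfun.rep_eq)

lemma complex_linear_P: "complex_linear (P z)"
  using A_linear by (auto simp: complex_linear_def P_apply scaleC_sum_right scaleC_left_commute intro!: sum.cong)

definition adj :: "nat \<Rightarrow> 'e \<Rightarrow> 'e"
  where "adj j = blinfun_apply (cadjoint (A j))"

lemma cinner_adj: "j \<le> d \<Longrightarrow> cinner (blinfun_apply (A j) x) y = cinner x (adj j y)"
  by (simp add: adj_def cinner_cadjoint A_linear)

lemma cadjoint_P: "cadjoint (P w) = (\<Sum>j\<le>d. scaleC_blinfun (cnj w ^ j) (cadjoint (A j)))"
proof (rule cadjoint_eqI)
  fix x y
  have sum_right: "cinner x (\<Sum>j\<in>I. f j) = (\<Sum>j\<in>I. cinner x (f j))" for f :: "nat \<Rightarrow> 'e" and I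
    by (induction I rule: infinite_finite_induct) (simp_all add: cinner_add_right)
  show "cinner (blinfun_apply (P w) x) y
      = cinner x (blinfun_apply (\<Sum>j\<le>d. scaleC_blinfun (cnj w ^ j) (cadjoint (A j))) y)"
    by (simp add: P_apply cinner_sum_left sum_right blinfun.sum_left scaleC_blinfun.rep_eq
        cinner_scaleC_left cinner_scaleC_right cinner_cadjoint A_linear cong: sum.cong_simp)
qed

lemma cadjoint_P_apply: "blinfun_apply (cadjoint (P w)) y = (\<Sum>j\<le>d. cnj w ^ j *\<^sub>C adj j y)"
  by (simp add: cadjoint_P blinfun.sum_left scaleC_blinfun.rep_eq adj_def)

lemma scalar_kernel_sums:
  assumes "z \<in> disc" "w \<in> disc"
  shows "(\<lambda>n. complex_of_real ((\<beta> n)\<^sup>2) * z ^ n * cnj w ^ n) sums scalar_kernel \<beta> z w"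
proof -
  have "cmod z * cmod w < 1 * 1"
    using assms by (intro mult_strict_mono') auto
  then have "z * cnj w \<in> disc"
    by (simp add: norm_mult)
  from summable_weights_power2[OF beta_pos beta_ratio this] show ?thesis
    unfolding scalar_kernel_def by (intro summable_sums) (simp add: power_mult_distrib mult.assoc)
qed

lemma K\<^sub>P_apply: "blinfun_apply (K\<^sub>P \<beta> d A z w) \<eta>
    = scalar_kernel \<beta> z w *\<^sub>C blinfun_apply (P z) (blinfun_apply (cadjoint (P w)) \<eta>)"
  using complex_linear_P[of z]
  by (simp add: K\<^sub>P_def diagonal_kernel_def scaleC_blinfun.rep_eq complex_linear_def)

section \<open>Evaluation and the reproducing property\<close>

lemma ev_linear: "z \<in> disc \<Longrightarrow> ev (c *\<^sub>C f + g) z = c *\<^sub>C ev f z + ev g z"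
  using H_P unfolding analytic_rkhs_def by blast

lemma ev_eqI: "(\<And>z. z \<in> disc \<Longrightarrow> ev f z = ev g z) \<Longrightarrow> f = g"
  using H_P unfolding analytic_rkhs_def by blast

lemma ker_exists: "w \<in> disc \<Longrightarrow> \<exists>k. is_ker w \<eta> k"
  using H_P unfolding analytic_rkhs_def by blast

lemma ker_total: "total {k. \<exists>w\<in>disc. \<exists>\<eta>. is_ker w \<eta> k}"
  using H_P unfolding analytic_rkhs_def by blast

lemma cinner_ker: "w \<in> disc \<Longrightarrow> is_ker w \<eta> k \<Longrightarrow> cinner f k = cinner (ev f w) \<eta>"
  using H_P unfolding analytic_rkhs_def by blast

lemma ev_add: "z \<in> disc \<Longrightarrow> ev (f + g) z = ev f z + ev g z"
  using ev_linear[of z 1 f g] by simp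

lemma ev_zero: "z \<in> disc \<Longrightarrow> ev 0 z = 0"
  using ev_add[of z 0 0] by simp

lemma ev_scaleC: "z \<in> disc \<Longrightarrow> ev (c *\<^sub>C f) z = c *\<^sub>C ev f z"
  using ev_linear[of z c f 0] ev_zero[of z] by simp

lemma ev_sum: "z \<in> disc \<Longrightarrow> ev (\<Sum>i\<in>I. f i) z = (\<Sum>i\<in>I. ev (f i) z)"
  by (induction I rule: infinite_finite_induct) (simp_all add: ev_zero ev_add)

lemma ker_scaleC: "is_ker w \<eta> k \<Longrightarrow> is_ker w (c *\<^sub>C \<eta>) (c *\<^sub>C k)"
  unfolding is_kernel_function_def
  by (simp add: ev_scaleC K\<^sub>P_apply complex_linear_P[unfolded complex_linear_def]
      complex_linear_cadjoint[OF complex_linear_P, unfolded complex_linear_def] scaleC_left_commute)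

text \<open>
  \<open>feature g c\<close> says that \<open>g\<close> is a finite sum of kernel functions and that \<open>c\<close> is its image
  under the isometry of the space into \<open>\<ell>\<^sup>2(\<nat>, \<E>)\<close> that takes \<open>K\<^sub>P(\<cdot>, w)\<eta>\<close> to
  \<open>(\<beta>\<^sub>m (cnj w)\<^sup>m P(w)\<^sup>*\<eta>)\<^sub>m\<close>.
\<close>

inductive feature :: "'h \<Rightarrow> (nat \<Rightarrow> 'e) \<Rightarrow> bool" where
  zero: "feature 0 (\<lambda>_. 0)"
| ker: "feature (k + g) (\<lambda>m. (\<beta> m * cnj w ^ m) *\<^sub>C blinfun_apply (cadjoint (P w)) \<eta> + c m)"
    if "w \<in> disc" "is_ker w \<eta> k" "feature g c"

lemma feature_add:
  assumes "feature g c" "feature g' c'"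
  shows "feature (g + g') (\<lambda>m. c m + c' m)"
  using assms(1)
proof induction
  case (ker w \<eta> k g c)
  from feature.ker[OF ker(1,2,4)] show ?case by (simp add: add.assoc)
qed (simp add: assms(2))

lemma feature_scaleC:
  assumes "feature g c"
  shows "feature (a *\<^sub>C g) (\<lambda>m. a *\<^sub>C c m)"
  using assms
proof induction
  case zero
  then show ?case by (simp add: feature.zero)
next
  case (ker w \<eta> k g c)
  from feature.ker[OF ker(1) ker_scaleC[OF ker(2), of a] ker(4)] show ?case
    by (simp add: scaleC_add_right scaleC_left_commute
        complex_linear_cadjoint[OF complex_linear_P, unfolded complex_linear_def])
qed

text \<open>The isometry property. Induction on both arguments reduces it to two kernel functions,
  where the reproducing property gives a value of \<open>scalar_kernel\<close> times an inner
  product, and the series of \<open>scalar_kernel\<close> gives the terms.\<close>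

lemma feature_inner:
  assumes "feature g c" "feature g' c'"
  shows "(\<lambda>m. cinner (c m) (c' m)) sums cinner g g'"
  using assms(1)
proof induction
  case (ker w \<eta> k g c)
  have "(\<lambda>m. cinner ((\<beta> m * cnj w ^ m) *\<^sub>C blinfun_apply (cadjoint (P w)) \<eta>) (c' m)) sums cinner k g'"
    using assms(2)
  proof induction
    case (ker w' \<eta>' k' g' c')
    let ?y = "blinfun_apply (cadjoint (P w)) \<eta>" and ?y' = "blinfun_apply (cadjoint (P w')) \<eta>'"
    have "cinner k k' = scalar_kernel \<beta> w' w * cinner ?y ?y'"
      using cinner_ker[OF ker(1,2)] \<open>is_ker w \<eta> k\<close> ker(1)
      by (simp add: is_kernel_function_def K\<^sub>P_apply cinner_scaleC_left cinner_cadjoint[OF complex_linear_P])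
    moreover have "(\<lambda>m. complex_of_real ((\<beta> m)\<^sup>2) * w' ^ m * cnj w ^ m * cinner ?y ?y') sums
        (scalar_kernel \<beta> w' w * cinner ?y ?y')"
      by (intro sums_mult2 scalar_kernel_sums ker(1) \<open>w \<in> disc\<close>)
    ultimately have "(\<lambda>m. cinner ((\<beta> m * cnj w ^ m) *\<^sub>C ?y) ((\<beta> m * cnj w' ^ m) *\<^sub>C ?y')) sums cinner k k'"
      by (simp add: cinner_scaleC_left cinner_scaleC_right power2_eq_square mult_ac)
    from sums_add[OF this ker(4)] show ?case by (simp add: cinner_add_right)
  qed simp
  from sums_add[OF this ker(4)] show ?case by (simp add: cinner_add_left)
qed simp

text \<open>One coordinate is at most the square-summable norm, which is \<open>norm g\<close> by
  isometry.\<close>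

lemma feature_bound:
  assumes "feature g c"
  shows "norm (c n) \<le> norm g"
proof -
  have "(\<lambda>m. (norm (c m))\<^sup>2) sums (norm g)\<^sup>2"
    using sums_Re[OF feature_inner[OF assms assms]] by (simp add: cinner_self)
  then have "(norm (c n))\<^sup>2 \<le> (norm g)\<^sup>2"
    using sum_le_suminf[of "\<lambda>m. (norm (c m))\<^sup>2" "{n}"] by (simp add: sums_iff)
  then show ?thesis by (rule power2_le_imp_le) simp
qed

text \<open>The adjoint of the isometry applied to the sequence with \<open>\<xi>\<close> in place
  \<open>n\<close> and 0 elsewhere; hence the factor \<open>\<beta> n\<close> and the norm
  bound.\<close>

definition monomial :: "nat \<Rightarrow> 'e \<Rightarrow> 'h"
  where "monomial n \<xi> = (THE h. \<forall>w\<in>disc. ev h w = (\<beta> n * w ^ n) *\<^sub>C blinfun_apply (P w) \<xi>)"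

text \<open>The vector represents the functional taking a sum of kernel functions to the real inner
  product of its \<open>n\<close>-th coordinate with \<open>\<xi>\<close>. Given as a relation, the
  functional needs no separate proof of single-valuedness: the bound contains it.\<close>

lemma monomial_exists:
  "\<exists>h. (\<forall>w\<in>disc. ev h w = (\<beta> n * w ^ n) *\<^sub>C blinfun_apply (P w) \<xi>) \<and> norm h \<le> norm \<xi>"
proof -
  define F where "F g e \<longleftrightarrow> (\<exists>c. feature g c \<and> c n = e)" for g e
  have F_zero: "F 0 0"
    unfolding F_def using feature.zero by (intro exI[of _ "\<lambda>_. 0"]) simp
  have F_add: "F (g + g') (e + e')" if "F g e" "F g' e'" for g g' e e'
    using that feature_add unfolding F_def by fast
  have F_scaleR: "F (a *\<^sub>R g) (a *\<^sub>R e)" if "F g e" for a g e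
    using that feature_scaleC[where a = "complex_of_real a"] unfolding F_def scaleC_of_real by fast
  have F_bound: "norm e \<le> norm g" if "F g e" for g e
    using that feature_bound unfolding F_def by blast
  let ?R = "{(g, inner e \<xi>) |g e. F g e}"
  have "subspace ?R"
    unfolding subspace_def
  proof (intro conjI ballI allI)
    show "0 \<in> ?R"
      using F_zero by (auto simp: zero_prod_def intro!: exI[of _ 0])
    show "x + y \<in> ?R" if xy: "x \<in> ?R" "y \<in> ?R" for x y
    proof -
      obtain g e g' e' where "x = (g, inner e \<xi>)" "F g e" "y = (g', inner e' \<xi>)" "F g' e'"
        using xy by blast
      then have "x + y = (g + g', inner (e + e') \<xi>)" "F (g + g') (e + e')"
        by (simp_all add: inner_add_left F_add)
      then show ?thesis by blast
    qed
    show "a *\<^sub>R x \<in> ?R" if x: "x \<in> ?R" for a x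
    proof -
      obtain g e where "x = (g, inner e \<xi>)" "F g e"
        using x by blast
      then have "a *\<^sub>R x = (a *\<^sub>R g, inner (a *\<^sub>R e) \<xi>)" "F (a *\<^sub>R g) (a *\<^sub>R e)"
        by (simp_all add: F_scaleR)
      then show ?thesis by blast
    qed
  qed
  moreover have "\<bar>r\<bar> \<le> norm \<xi> * norm x" if xr: "(x, r) \<in> ?R" for x r
  proof -
    obtain e where e: "F x e" "r = inner e \<xi>"
      using xr by blast
    have "\<bar>r\<bar> \<le> norm e * norm \<xi>"
      using e(2) Cauchy_Schwarz_ineq2 by blast
    also have "\<dots> \<le> norm x * norm \<xi>"
      by (intro mult_right_mono F_bound[OF e(1)]) simp
    finally show ?thesis by (simp add: mult.commute)
  qed
  ultimately obtain h where h: "\<And>x r. (x, r) \<in> ?R \<Longrightarrow> inner x h = r" "norm h \<le> norm \<xi>"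
    using riesz_relation[of ?R "norm \<xi>", OF _ _ norm_ge_zero] by blast
  have "ev h w = (\<beta> n * w ^ n) *\<^sub>C blinfun_apply (P w) \<xi>" if w: "w \<in> disc" for w :: complex
  proof -
    \<comment> \<open>Pairing \<open>h\<close> with the kernel function at \<open>w\<close>
      identifies its value there; real inner products suffice since \<open>\<eta>\<close> is
      arbitrary.\<close>
    have "inner \<eta> (ev h w) = inner \<eta> ((\<beta> n * w ^ n) *\<^sub>C blinfun_apply (P w) \<xi>)" for \<eta>
    proof -
      obtain k where k: "is_ker w \<eta> k"
        using ker_exists[OF w] by blast
      have "F k ((\<beta> n * cnj w ^ n) *\<^sub>C blinfun_apply (cadjoint (P w)) \<eta>)"
        unfolding F_def using feature.ker[OF w k feature.zero]
        by (intro exI[of _ "\<lambda>m. (\<beta> m * cnj w ^ m) *\<^sub>C blinfun_apply (cadjoint (P w)) \<eta>"]) simp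
      then have "inner k h = inner ((\<beta> n * cnj w ^ n) *\<^sub>C blinfun_apply (cadjoint (P w)) \<eta>) \<xi>"
        by (intro h(1)) blast
      moreover have "inner h k = inner (ev h w) \<eta>"
        using cinner_ker[OF w k, of h] by (simp add: Re_cinner[symmetric])
      moreover have "cinner \<xi> ((\<beta> n * cnj w ^ n) *\<^sub>C blinfun_apply (cadjoint (P w)) \<eta>)
          = cinner ((\<beta> n * w ^ n) *\<^sub>C blinfun_apply (P w) \<xi>) \<eta>"
        by (simp add: cinner_scaleC_left cinner_scaleC_right cinner_cadjoint[OF complex_linear_P])
      then have "inner \<xi> ((\<beta> n * cnj w ^ n) *\<^sub>C blinfun_apply (cadjoint (P w)) \<eta>)
          = inner ((\<beta> n * w ^ n) *\<^sub>C blinfun_apply (P w) \<xi>) \<eta>"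
        by (simp add: Re_cinner[symmetric])
      ultimately show ?thesis
        by (simp add: inner_commute)
    qed
    then show ?thesis
      by (metis inner_commute vector_eq_rdot)
  qed
  with h(2) show ?thesis
    by (intro exI[of _ h]) auto
qed

lemma
  fixes w :: complex
  shows ev_monomial: "w \<in> disc \<Longrightarrow> ev (monomial n \<xi>) w = (\<beta> n * w ^ n) *\<^sub>C blinfun_apply (P w) \<xi>"
    and norm_monomial: "norm (monomial n \<xi>) \<le> norm \<xi>"
proof -
  obtain h where h: "\<forall>w\<in>disc. ev h w = (\<beta> n * w ^ n) *\<^sub>C blinfun_apply (P w) \<xi>" "norm h \<le> norm \<xi>"
    using monomial_exists by blast
  have "monomial n \<xi> = h"
    unfolding monomial_def using h(1) by (intro the_equality ev_eqI) simp_all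
  with h show "norm (monomial n \<xi>) \<le> norm \<xi>"
    and "w \<in> disc \<Longrightarrow> ev (monomial n \<xi>) w = (\<beta> n * w ^ n) *\<^sub>C blinfun_apply (P w) \<xi>"
    by auto
qed

lemma monomial_add: "monomial n (x + y) = monomial n x + monomial n y"
  by (rule ev_eqI) (simp add: ev_monomial ev_add blinfun.add_right scaleC_add_right)

lemma monomial_scaleC: "monomial n (c *\<^sub>C x) = c *\<^sub>C monomial n x"
  by (rule ev_eqI)
    (simp add: ev_monomial ev_scaleC complex_linear_P[unfolded complex_linear_def] scaleC_left_commute)

lemma bounded_linear_monomial: "bounded_linear (monomial n)"
proof (rule bounded_linear_intro)
  show "monomial n (r *\<^sub>R x) = r *\<^sub>R monomial n x" for r x
    by (metis monomial_scaleC scaleC_of_real)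
  show "norm (monomial n x) \<le> norm x * 1" for x
    by (simp add: norm_monomial)
qed (rule monomial_add)

text \<open>The \<open>n\<close>-th Taylor coefficient at 0 of \<open>cnj w \<mapsto> K\<^sub>P(\<cdot>, w)\<eta>\<close>.\<close>

definition taylor :: "nat \<Rightarrow> 'e \<Rightarrow> 'h"
  where "taylor n \<eta> = (\<Sum>i\<le>d. if i \<le> n then \<beta> (n - i) *\<^sub>R monomial (n - i) (adj i \<eta>) else 0)"

lemma bounded_linear_taylor: "bounded_linear (taylor n)"
proof -
  have "bounded_linear (\<lambda>\<eta>. if i \<le> n then \<beta> (n - i) *\<^sub>R monomial (n - i) (adj i \<eta>) else 0)" for i
    unfolding adj_def
    by (cases "i \<le> n") (auto intro!: bounded_linear_const_scaleR
        bounded_linear_compose[OF bounded_linear_monomial] blinfun.bounded_linear_right)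
  then show ?thesis
    unfolding taylor_def[abs_def] by (rule bounded_linear_sum)
qed

lemma norm_taylor_le:
  "norm (taylor n \<eta>) \<le> (\<Sum>i\<le>d. if i \<le> n then \<beta> (n - i) * norm (adj i \<eta>) else 0)"
  unfolding taylor_def
proof (rule sum_norm_le)
  fix i
  show "norm (if i \<le> n then \<beta> (n - i) *\<^sub>R monomial (n - i) (adj i \<eta>) else 0)
      \<le> (if i \<le> n then \<beta> (n - i) * norm (adj i \<eta>) else 0)"
    using beta_pos[of "n - i"] norm_monomial[of "n - i" "adj i \<eta>"] by (simp add: mult_left_mono)
qed

text \<open>Norms of monomials are bounded, so the series in \<open>cnj w\<close> converge
  absolutely by \<open>summable_weights\<close>. Their sums are identified pointwise and then
  combined through the polynomial \<open>cadjoint (P w)\<close>.\<close>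

lemma ker_sums:
  assumes w: "w \<in> disc" and k: "is_ker w \<eta> k"
  shows "(\<lambda>n. cnj w ^ n *\<^sub>C taylor n \<eta>) sums k"
proof -
  have term_sums: "\<exists>s. (\<lambda>n. cnj w ^ n *\<^sub>C (\<beta> n *\<^sub>R monomial n \<xi>)) sums s \<and>
      (\<forall>z\<in>disc. ev s z = scalar_kernel \<beta> z w *\<^sub>C blinfun_apply (P z) \<xi>)" for \<xi>
  proof -
    have "summable (\<lambda>n. cnj w ^ n *\<^sub>C (\<beta> n *\<^sub>R monomial n \<xi>))"
    proof (rule summable_comparison_test)
      show "summable (\<lambda>n. \<beta> n * cmod w ^ n * norm \<xi>)"
        using w by (intro summable_mult2 summable_weights[OF beta_pos beta_ratio]) auto
      have "norm (cnj w ^ n *\<^sub>C (\<beta> n *\<^sub>R monomial n \<xi>)) \<le> \<beta> n * cmod w ^ n * norm \<xi>" for n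
        using mult_left_mono[OF norm_monomial, of "\<beta> n * cmod w ^ n" n \<xi>] beta_pos[of n]
        by (simp add: norm_scaleC norm_power mult_ac)
      then show "\<exists>N. \<forall>n\<ge>N. norm (cnj w ^ n *\<^sub>C (\<beta> n *\<^sub>R monomial n \<xi>)) \<le> \<beta> n * cmod w ^ n * norm \<xi>"
        by blast
    qed
    then obtain s where s: "(\<lambda>n. cnj w ^ n *\<^sub>C (\<beta> n *\<^sub>R monomial n \<xi>)) sums s"
      by (auto simp: summable_def)
    \<comment> \<open>Pairing with the kernel function at \<open>z\<close> turns convergence in the
      space into the scalar series of \<open>scalar_kernel\<close>.\<close>
    have "ev s z = scalar_kernel \<beta> z w *\<^sub>C blinfun_apply (P z) \<xi>" if z: "z \<in> disc" for z
    proof -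
      have "cinner (ev s z) \<zeta> = cinner (scalar_kernel \<beta> z w *\<^sub>C blinfun_apply (P z) \<xi>) \<zeta>" for \<zeta>
      proof -
        obtain k' where k': "is_ker z \<zeta> k'"
          using ker_exists[OF z] by blast
        have sums_k': "(\<lambda>n. cinner (cnj w ^ n *\<^sub>C (\<beta> n *\<^sub>R monomial n \<xi>)) k') sums cinner s k'"
          by (rule bounded_linear.sums[OF bounded_linear_cinner_left s])
        have terms: "cinner (cnj w ^ n *\<^sub>C (\<beta> n *\<^sub>R monomial n \<xi>)) k'
            = complex_of_real ((\<beta> n)\<^sup>2) * z ^ n * cnj w ^ n * cinner (blinfun_apply (P z) \<xi>) \<zeta>" for n
          unfolding cinner_ker[OF z k']
          by (simp add: ev_scaleC[OF z] ev_monomial[OF z] scaleC_of_real[symmetric] cinner_scaleC_left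
              power2_eq_square mult_ac)
        have "(\<lambda>n. complex_of_real ((\<beta> n)\<^sup>2) * z ^ n * cnj w ^ n * cinner (blinfun_apply (P z) \<xi>) \<zeta>)
            sums (scalar_kernel \<beta> z w * cinner (blinfun_apply (P z) \<xi>) \<zeta>)"
          by (intro sums_mult2 scalar_kernel_sums z w)
        from sums_unique2[OF sums_k'[unfolded terms] this] show ?thesis
          using cinner_ker[OF z k', of s] by (simp add: cinner_scaleC_left)
      qed
      then show ?thesis
        by (rule cinner_ext_left)
    qed
    with s show ?thesis by blast
  qed
  then obtain s where s: "\<And>\<xi>. (\<lambda>n. cnj w ^ n *\<^sub>C (\<beta> n *\<^sub>R monomial n \<xi>)) sums s \<xi>"
    "\<And>\<xi> z. z \<in> disc \<Longrightarrow> ev (s \<xi>) z = scalar_kernel \<beta> z w *\<^sub>C blinfun_apply (P z) \<xi>"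
    by metis
  \<comment> \<open>The \<open>i\<close>-th term of \<open>cadjoint (P w)\<close> delays the series
    for \<open>adj i \<eta>\<close> by \<open>i\<close> places; collecting powers of
    \<open>cnj w\<close> gives \<open>taylor\<close>.\<close>
  have "(\<lambda>n. \<Sum>i\<le>d. cnj w ^ i *\<^sub>C (if i \<le> n then cnj w ^ (n - i) *\<^sub>C (\<beta> (n - i) *\<^sub>R monomial (n - i) (adj i \<eta>)) else 0))
      sums (\<Sum>i\<le>d. cnj w ^ i *\<^sub>C s (adj i \<eta>))"
    by (intro sums_sum bounded_linear.sums[OF bounded_linear_scaleC] sums_shift_conv[THEN iffD2] s(1))
  also have "(\<lambda>n. \<Sum>i\<le>d. cnj w ^ i *\<^sub>C (if i \<le> n then cnj w ^ (n - i) *\<^sub>C (\<beta> (n - i) *\<^sub>R monomial (n - i) (adj i \<eta>)) else 0))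
      = (\<lambda>n. cnj w ^ n *\<^sub>C taylor n \<eta>)"
    unfolding taylor_def scaleC_sum_right
    by (intro ext sum.cong) (auto simp: scaleC_scaleC power_add[symmetric])
  also have "(\<Sum>i\<le>d. cnj w ^ i *\<^sub>C s (adj i \<eta>)) = k"
  proof (rule ev_eqI)
    fix z assume z: "z \<in> disc"
    interpret Pz: bounded_linear "blinfun_apply (P z)"
      by (rule blinfun.bounded_linear_right)
    show "ev (\<Sum>i\<le>d. cnj w ^ i *\<^sub>C s (adj i \<eta>)) z = ev k z"
      using k z by (simp add: is_kernel_function_def K\<^sub>P_apply cadjoint_P_apply ev_sum ev_scaleC s(2)
          Pz.sum scaleC_sum_right complex_linear_P[unfolded complex_linear_def] scaleC_left_commute)
  qed
  finally show ?thesis .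
qed

text \<open>Kernel functions are limits of partial sums of \<open>ker_sums\<close>. Complex
  multiples stay in the real span because scalars can be absorbed into
  \<open>\<eta>\<close>.\<close>

lemma span_taylor_dense: "closure (span (\<Union>n. range (taylor n))) = UNIV"
proof -
  let ?V = "span (\<Union>n. range (taylor n))"
  have "taylor n (c *\<^sub>C \<eta>) = c *\<^sub>C taylor n \<eta>" for n c \<eta>
  proof -
    have "adj i (c *\<^sub>C \<eta>) = c *\<^sub>C adj i \<eta>" if "i \<le> d" for i
      using complex_linear_cadjoint[OF A_linear[OF that]] by (simp add: adj_def complex_linear_def)
    then show ?thesis
      unfolding taylor_def scaleC_sum_right
      by (intro sum.cong) (auto simp: monomial_scaleC scaleC_scaleR)
  qed
  then have "c *\<^sub>C taylor n \<eta> \<in> ?V" for n c \<eta>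
    by (simp flip: \<open>\<And>n c \<eta>. taylor n (c *\<^sub>C \<eta>) = c *\<^sub>C taylor n \<eta>\<close>) (blast intro: span_base)
  moreover have "c *\<^sub>C k \<in> closure ?V" if "w \<in> disc" "is_ker w \<eta> k" for c w \<eta> k
  proof -
    have "(\<lambda>n. c *\<^sub>C (\<Sum>i<n. cnj w ^ i *\<^sub>C taylor i \<eta>)) \<longlonglongrightarrow> c *\<^sub>C k"
      using ker_sums[OF that] unfolding sums_def by (rule bounded_linear.tendsto[OF bounded_linear_scaleC])
    moreover have "c *\<^sub>C (\<Sum>i<n. cnj w ^ i *\<^sub>C taylor i \<eta>) \<in> ?V" for n
      unfolding scaleC_sum_right scaleC_scaleC by (intro span_sum \<open>\<And>n c \<eta>. c *\<^sub>C taylor n \<eta> \<in> ?V\<close>)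
    ultimately show ?thesis
      unfolding closure_sequential by (intro exI[of _ "\<lambda>n. c *\<^sub>C (\<Sum>i<n. cnj w ^ i *\<^sub>C taylor i \<eta>)"]) blast
  qed
  then have "cspan {k. \<exists>w\<in>disc. \<exists>\<eta>. is_ker w \<eta> k} \<subseteq> closure ?V"
    unfolding cspan_def by (intro span_minimal subspace_closure subspace_span) auto
  then have "closure (cspan {k. \<exists>w\<in>disc. \<exists>\<eta>. is_ker w \<eta> k}) \<subseteq> closure ?V"
    by (intro closure_minimal closed_closure)
  then show ?thesis
    using ker_total unfolding total_def by auto
qed

end

section \<open>Hypercyclicity\<close>

locale operator_poly_shift = operator_poly_rkhs \<beta> d A ev
  for \<beta> d and A :: "nat \<Rightarrow> 'e::complex_hilbert \<Rightarrow>\<^sub>L 'e" and ev :: "'h::complex_hilbert \<Rightarrow> complex \<Rightarrow> 'e" +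
  fixes M :: "'h \<Rightarrow>\<^sub>L 'h"
  assumes Mz: "is_Mz ev M"
begin

lemma ev_M: "w \<in> disc \<Longrightarrow> ev (blinfun_apply M f) w = w *\<^sub>C ev f w"
  using Mz unfolding is_Mz_def by blast

lemma complex_linear_M: "complex_linear M"
  unfolding complex_linear_def
  by (intro allI ev_eqI) (simp only: ev_M ev_scaleC scaleC_left_commute)

text \<open>On monomials \<open>M\<close> is a weighted forward shift whose weights
  telescope.\<close>

lemma M_pow_monomial_0: "(blinfun_apply M ^^ n) (monomial 0 \<xi>) = (\<beta> 0 / \<beta> n) *\<^sub>R monomial n \<xi>"
proof (induction n)
  case 0
  then show ?case using beta_pos[of 0] by simp
next
  case (Suc n)
  have "blinfun_apply M (monomial n \<xi>) = (\<beta> n / \<beta> (Suc n)) *\<^sub>R monomial (Suc n) \<xi>"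
  proof (rule ev_eqI)
    fix z :: complex assume "z \<in> disc"
    then show "ev (blinfun_apply M (monomial n \<xi>)) z = ev ((\<beta> n / \<beta> (Suc n)) *\<^sub>R monomial (Suc n) \<xi>) z"
      using beta_pos[of "Suc n"]
      by (simp only: ev_M ev_monomial scaleC_of_real[symmetric] ev_scaleC scaleC_scaleC) (simp add: mult_ac)
  qed
  then show ?case
    using beta_pos[of n] by (simp add: Suc blinfun.scaleR_right)
qed

lemma cinner_M_pow:
  "cinner ((blinfun_apply M ^^ n) x) y = cinner x ((blinfun_apply (cadjoint M) ^^ n) y)"
proof (induction n arbitrary: y)
  case (Suc n)
  show ?case
    using Suc.IH[of "blinfun_apply (cadjoint M) y"]
    by (simp add: cinner_cadjoint[OF complex_linear_M] funpow_swap1[of "blinfun_apply (cadjoint M)"])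
qed simp

lemma not_hypercyclic_if_bounded_below:
  assumes c: "c > 0" "\<And>n. c \<le> \<beta> n" and \<xi>: "blinfun_apply (A 0) \<xi> \<noteq> 0"
  shows "\<not> hypercyclic (cadjoint M)"
proof
  assume "hypercyclic (cadjoint M)"
  then obtain x where x: "closure (range (\<lambda>n. (blinfun_apply (cadjoint M) ^^ n) x)) = UNIV"
    unfolding hypercyclic_def by blast
  define h where "h = monomial 0 \<xi>"
  \<comment> \<open>At 0 only the term \<open>j = 0\<close> of the polynomial survives.\<close>
  have "ev h 0 = \<beta> 0 *\<^sub>R blinfun_apply (A 0) \<xi>"
    by (simp add: h_def ev_monomial P_apply power_0_left scaleC_of_real if_distrib[of "\<lambda>c. c *\<^sub>C _"] cong: if_cong)
  then have "h \<noteq> 0"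
    using \<xi> beta_pos[of 0] ev_zero[of 0] by auto
  define B where "B = \<beta> 0 / c * norm \<xi> * norm x"
  have "B \<ge> 0"
    using c beta_pos[of 0] by (simp add: B_def)
  have "closed {y. \<bar>inner h y\<bar> \<le> B}"
    by (intro closed_Collect_le continuous_intros)
  moreover have "(blinfun_apply (cadjoint M) ^^ n) x \<in> {y. \<bar>inner h y\<bar> \<le> B}" for n
  proof -
    have "inner h ((blinfun_apply (cadjoint M) ^^ n) x) = inner ((\<beta> 0 / \<beta> n) *\<^sub>R monomial n \<xi>) x"
      using cinner_M_pow[of n h x] by (simp add: h_def M_pow_monomial_0 Re_cinner[symmetric])
    also have "\<bar>\<dots>\<bar> \<le> norm ((\<beta> 0 / \<beta> n) *\<^sub>R monomial n \<xi>) * norm x"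
      by (rule Cauchy_Schwarz_ineq2)
    also have "\<dots> = \<beta> 0 / \<beta> n * norm (monomial n \<xi>) * norm x"
      using beta_pos by (simp add: less_imp_le)
    also have "\<dots> \<le> B"
      unfolding B_def using c beta_pos[of 0]
      by (intro mult_right_mono mult_mono frac_le norm_monomial) auto
    finally show ?thesis by simp
  qed
  ultimately have "closure (range (\<lambda>n. (blinfun_apply (cadjoint M) ^^ n) x)) \<subseteq> {y. \<bar>inner h y\<bar> \<le> B}"
    by (intro closure_minimal) auto
  \<comment> \<open>This multiple of \<open>h\<close> has inner product \<open>B + 1\<close> with
    \<open>h\<close>, so it lies outside the closed slab containing the orbit.\<close>
  then have "((B + 1) / (norm h)\<^sup>2) *\<^sub>R h \<in> {y. \<bar>inner h y\<bar> \<le> B}"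
    unfolding x by blast
  then show False
    using \<open>h \<noteq> 0\<close> \<open>B \<ge> 0\<close> by (simp add: power2_norm_eq_inner[symmetric] abs_mult)
qed

lemma cadjoint_M_ker:
  assumes "w \<in> disc" "is_ker w \<eta> k"
  shows "blinfun_apply (cadjoint M) k = cnj w *\<^sub>C k"
  by (rule cinner_ext)
    (simp add: cinner_cadjoint[OF complex_linear_M, symmetric] cinner_ker[OF assms] ev_M[OF assms(1)]
      cinner_scaleC_left cinner_scaleC_right)

text \<open>Kernel functions are eigenvectors of the adjoint with eigenvalue \<open>cnj w\<close>;
  expanding both sides of the eigenvalue equation by \<open>ker_sums\<close> and comparing
  coefficients gives the shift.\<close>

lemma cadjoint_M_taylor:
  "blinfun_apply (cadjoint M) (taylor n \<eta>) = (if 1 \<le> n then taylor (n - 1) \<eta> else 0)"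
proof (rule cinner_ext_left)
  fix f
  let ?a = "\<lambda>n. cinner (blinfun_apply (cadjoint M) (taylor n \<eta>)) f - cinner (if 1 \<le> n then taylor (n - 1) \<eta> else 0) f"
  have "?a n = 0"
  proof (rule power_series_zero_coeff[where a = ?a])
    fix z :: complex assume "z \<in> disc"
    \<comment> \<open>Taking the kernel function at \<open>cnj z\<close> makes its expansion a power
      series in \<open>z\<close>.\<close>
    then have w: "cnj z \<in> disc" by simp
    obtain k where k: "is_ker (cnj z) \<eta> k"
      using ker_exists[OF w] by blast
    have k_sums: "(\<lambda>n. z ^ n *\<^sub>C taylor n \<eta>) sums k"
      using ker_sums[OF w k] by simp
    have "(\<lambda>n. cinner (blinfun_apply (cadjoint M) (z ^ n *\<^sub>C taylor n \<eta>)) f)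
        sums cinner (blinfun_apply (cadjoint M) k) f"
      by (intro bounded_linear.sums[OF bounded_linear_cinner_left]
          bounded_linear.sums[OF blinfun.bounded_linear_right] k_sums)
    moreover have "blinfun_apply (cadjoint M) (z ^ n *\<^sub>C taylor n \<eta>)
        = z ^ n *\<^sub>C blinfun_apply (cadjoint M) (taylor n \<eta>)" for n
      using complex_linear_cadjoint[OF complex_linear_M] by (simp add: complex_linear_def)
    ultimately have M_sums: "(\<lambda>n. z ^ n * cinner (blinfun_apply (cadjoint M) (taylor n \<eta>)) f)
        sums (z * cinner k f)"
      by (simp add: cinner_scaleC_left cadjoint_M_ker[OF w k])
    have "(\<lambda>n. cinner (z *\<^sub>C (if 1 \<le> n then z ^ (n - 1) *\<^sub>C taylor (n - 1) \<eta> else 0)) f)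
        sums cinner (z *\<^sub>C k) f"
      by (intro bounded_linear.sums[OF bounded_linear_cinner_left]
          bounded_linear.sums[OF bounded_linear_scaleC] sums_shift_conv[THEN iffD2] k_sums)
    moreover have "cinner (z *\<^sub>C (if 1 \<le> n then z ^ (n - 1) *\<^sub>C taylor (n - 1) \<eta> else 0)) f
        = z ^ n * cinner (if 1 \<le> n then taylor (n - 1) \<eta> else 0) f" for n
      by (cases n) (simp_all add: cinner_scaleC_left mult.assoc)
    ultimately have "(\<lambda>n. z ^ n * cinner (if 1 \<le> n then taylor (n - 1) \<eta> else 0) f) sums (z * cinner k f)"
      by (simp only: cinner_scaleC_left)
    from sums_diff[OF M_sums this] show "(\<lambda>n. ?a n * z ^ n) sums 0"
      by (simp add: algebra_simps)
  qed
  then show "cinner (blinfun_apply (cadjoint M) (taylor n \<eta>)) f = cinner (if 1 \<le> n then taylor (n - 1) \<eta> else 0) f"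
    by simp
qed

lemma hypercyclic_if_weights_small:
  assumes sep: "separable_space (euclidean :: 'e topology)"
    and r: "strict_mono r" and lim: "(\<lambda>k. \<beta> (r k)) \<longlonglongrightarrow> 0"
  shows "hypercyclic (cadjoint M)"
proof -
  obtain E :: "'e set" where E: "countable E" "closure E = UNIV"
    using sep by (auto simp: separable_space_def)
  show ?thesis
  proof (rule hypercyclic_backward_shift[OF E bounded_linear_taylor _ _ span_taylor_dense])
    \<comment> \<open>The extra \<open>d\<close> makes every index \<open>n + (r k + d) - i\<close>
      a forward shift of \<open>r k\<close>.\<close>
    show "filterlim (\<lambda>k. r k + d) at_top sequentially"
      by (rule filterlim_at_top_mono[OF filterlim_subseq[OF r]]) simp
    show "(\<lambda>k. taylor (n + (r k + d)) \<eta>) \<longlonglongrightarrow> 0" for n \<eta>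
    proof (rule tendsto_norm_zero_cancel, rule tendsto_sandwich[OF _ _ tendsto_const])
      have "(\<lambda>k. \<Sum>i\<le>d. \<beta> (r k + (n + (d - i))) * norm (adj i \<eta>)) \<longlonglongrightarrow> (\<Sum>i\<le>d. 0 * norm (adj i \<eta>))"
        by (intro tendsto_sum tendsto_mult tendsto_const weights_shift_tendsto_0[OF beta_pos beta_ratio r lim])
      then show "(\<lambda>k. \<Sum>i\<le>d. \<beta> (r k + (n + (d - i))) * norm (adj i \<eta>)) \<longlonglongrightarrow> 0"
        by simp
      have "norm (taylor (n + (r k + d)) \<eta>) \<le> (\<Sum>i\<le>d. \<beta> (r k + (n + (d - i))) * norm (adj i \<eta>))" for k
      proof -
        have "n + (r k + d) - i = r k + (n + (d - i))" if "i \<le> d" for i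
          using that by simp
        then show ?thesis
          using norm_taylor_le[of "n + (r k + d)" \<eta>] by (simp cong: sum.cong_simp)
      qed
      then show "eventually (\<lambda>k. norm (taylor (n + (r k + d)) \<eta>)
          \<le> (\<Sum>i\<le>d. \<beta> (r k + (n + (d - i))) * norm (adj i \<eta>))) sequentially"
        by simp
    qed simp
  qed (simp_all add: cadjoint_M_taylor)
qed

end

section \<open>Mixed derivatives\<close>

lemma bounded_linear_scaleC_blinfun_left:
  fixes B :: "'a::complex_hilbert \<Rightarrow>\<^sub>L 'b::complex_hilbert"
  shows "bounded_linear (\<lambda>c. scaleC_blinfun c B)"
proof (rule bounded_linear_intro)
  fix b c :: complex and r :: real
  show "scaleC_blinfun (b + c) B = scaleC_blinfun b B + scaleC_blinfun c B"
    by (rule blinfun_eqI) (simp add: scaleC_blinfun.rep_eq scaleC_add_left blinfun.add_left)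
  show "scaleC_blinfun (r *\<^sub>R c) B = r *\<^sub>R scaleC_blinfun c B"
    by (rule blinfun_eqI)
       (simp add: scaleC_blinfun.rep_eq scaleR_conv_of_real scaleC_scaleC[symmetric] scaleC_of_real blinfun.scaleR_left)
  show "norm (scaleC_blinfun c B) \<le> norm c * norm B"
    by (rule norm_blinfun_bound)
       (simp_all add: scaleC_blinfun.rep_eq norm_scaleC mult.assoc mult_left_mono norm_blinfun)
qed

text \<open>The formula for \<open>F\<close> is known on the disc only, so the derivative is
  computed on the open set of \<open>t\<close> that stay inside. The directions \<open>v = 1\<close>
  and \<open>v = \<i>\<close> give the two partial derivatives.\<close>

lemma vector_derivative_scaleC_blinfun_sum:
  fixes B :: "'p \<Rightarrow> 'a::complex_hilbert \<Rightarrow>\<^sub>L 'b::complex_hilbert"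
  assumes z: "z \<in> disc"
    and F: "\<And>u. u \<in> disc \<Longrightarrow> F u = (\<Sum>p\<in>I. scaleC_blinfun (g p u) (B p))"
    and g: "\<And>p. p \<in> I \<Longrightarrow> ((\<lambda>t. g p (z + v * complex_of_real t)) has_vector_derivative D p) (at 0)"
  shows "vector_derivative (\<lambda>t. F (z + v * complex_of_real t)) (at 0) = (\<Sum>p\<in>I. scaleC_blinfun (D p) (B p))"
proof (rule vector_derivative_at, rule has_vector_derivative_transform_within_open)
  show "((\<lambda>t. \<Sum>p\<in>I. scaleC_blinfun (g p (z + v * complex_of_real t)) (B p)) has_vector_derivative
      (\<Sum>p\<in>I. scaleC_blinfun (D p) (B p))) (at 0)"
    by (intro has_vector_derivative_sum
        bounded_linear.has_vector_derivative[OF bounded_linear_scaleC_blinfun_left] g)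
  show "open ((\<lambda>t. z + v * complex_of_real t) -` disc)"
    by (intro open_vimage open_ball continuous_intros)
qed (use z F in auto)

lemma scaleC_blinfun_sum_right:
  "scaleC_blinfun c (\<Sum>p\<in>I. T p) = (\<Sum>p\<in>I. scaleC_blinfun c (T p))"
  by (rule blinfun_eqI) (simp add: scaleC_blinfun.rep_eq blinfun.sum_left scaleC_sum_right)

lemma scaleC_blinfun_scaleC_blinfun: "scaleC_blinfun b (scaleC_blinfun c T) = scaleC_blinfun (b * c) T"
  by (rule blinfun_eqI) (simp add: scaleC_blinfun.rep_eq scaleC_scaleC)

lemma scaleC_blinfun_minus_left: "scaleC_blinfun (- c) T = - scaleC_blinfun c T"
  by (rule linear_neg[OF bounded_linear.linear[OF bounded_linear_scaleC_blinfun_left]])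

text \<open>By the chain rule the partial derivatives in \<open>x\<close> and \<open>y\<close> have
  coefficients \<open>D\<close> and \<open>\<i> * D\<close>, so the Wirtinger combination returns
  \<open>D\<close>.\<close>

lemma d_z_power_series:
  fixes B :: "'p \<Rightarrow> 'a::complex_hilbert \<Rightarrow>\<^sub>L 'b::complex_hilbert"
  assumes z: "z \<in> disc"
    and a: "\<And>p u. p \<in> I \<Longrightarrow> u \<in> disc \<Longrightarrow> summable (\<lambda>n. a p n * u ^ n)"
    and F: "\<And>u. u \<in> disc \<Longrightarrow> F u = (\<Sum>p\<in>I. scaleC_blinfun (\<Sum>n. a p n * u ^ n) (B p))"
  shows "d_z F z = (\<Sum>p\<in>I. scaleC_blinfun (\<Sum>n. diffs (a p) n * z ^ n) (B p))"
proof -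
  let ?D = "\<lambda>p. \<Sum>n. diffs (a p) n * z ^ n"
  have deriv: "((\<lambda>t. \<Sum>n. a p n * (z + v * complex_of_real t) ^ n) has_vector_derivative v * ?D p) (at 0)"
    if "p \<in> I" for p v
  proof -
    have "((\<lambda>t. z + v * complex_of_real t) has_vector_derivative v) (at 0)"
      by (auto intro!: derivative_eq_intros simp: has_vector_derivative_def scaleR_conv_of_real)
    moreover have "((\<lambda>u. \<Sum>n. a p n * u ^ n) has_field_derivative ?D p) (at (z + v * complex_of_real 0))"
      using termdiffs_strong'[of 1 "a p" z] a[OF that] z by simp
    ultimately show ?thesis
      by (rule field_vector_diff_chain_at[unfolded o_def])
  qed
  have "partial_x F z = (\<Sum>p\<in>I. scaleC_blinfun (?D p) (B p))"
    using vector_derivative_scaleC_blinfun_sum[OF z F deriv, of 1] by (simp add: partial_x_def)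
  moreover have "partial_y F z = (\<Sum>p\<in>I. scaleC_blinfun (\<i> * ?D p) (B p))"
    using vector_derivative_scaleC_blinfun_sum[OF z F deriv, of \<i>] by (simp add: partial_y_def)
  ultimately show ?thesis
    by (simp add: d_z_def scaleC_blinfun_sum_right scaleC_blinfun_scaleC_blinfun mult.assoc[symmetric]
        scaleC_blinfun_minus_left sum_negf)
qed

text \<open>The conjugation changes the coefficient in \<open>y\<close> to
  \<open>cnj \<i> * D\<close>, matching the opposite sign in \<open>d_zbar\<close>.\<close>

lemma d_zbar_power_series:
  fixes B :: "'p \<Rightarrow> 'a::complex_hilbert \<Rightarrow>\<^sub>L 'b::complex_hilbert"
  assumes z: "z \<in> disc"
    and a: "\<And>p u. p \<in> I \<Longrightarrow> u \<in> disc \<Longrightarrow> summable (\<lambda>n. a p n * u ^ n)"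
    and F: "\<And>u. u \<in> disc \<Longrightarrow> F u = (\<Sum>p\<in>I. scaleC_blinfun (\<Sum>n. a p n * cnj u ^ n) (B p))"
  shows "d_zbar F z = (\<Sum>p\<in>I. scaleC_blinfun (\<Sum>n. diffs (a p) n * cnj z ^ n) (B p))"
proof -
  let ?D = "\<lambda>p. \<Sum>n. diffs (a p) n * cnj z ^ n"
  have deriv: "((\<lambda>t. \<Sum>n. a p n * cnj (z + v * complex_of_real t) ^ n) has_vector_derivative cnj v * ?D p) (at 0)"
    if "p \<in> I" for p v
  proof -
    have "((\<lambda>t. cnj (z + v * complex_of_real t)) has_vector_derivative cnj v) (at 0)"
      by (auto intro!: derivative_eq_intros simp: has_vector_derivative_def scaleR_conv_of_real)
    moreover have "((\<lambda>u. \<Sum>n. a p n * u ^ n) has_field_derivative ?D p) (at (cnj (z + v * complex_of_real 0)))"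
      using termdiffs_strong'[of 1 "a p" "cnj z"] a[OF that] z by simp
    ultimately show ?thesis
      by (rule field_vector_diff_chain_at[unfolded o_def])
  qed
  have "partial_x F z = (\<Sum>p\<in>I. scaleC_blinfun (?D p) (B p))"
    using vector_derivative_scaleC_blinfun_sum[OF z F deriv, of 1] by (simp add: partial_x_def)
  moreover have "partial_y F z = (\<Sum>p\<in>I. scaleC_blinfun (cnj \<i> * ?D p) (B p))"
    using vector_derivative_scaleC_blinfun_sum[OF z F deriv, of \<i>] by (simp add: partial_y_def)
  ultimately show ?thesis
    by (simp add: d_zbar_def scaleC_blinfun_sum_right scaleC_blinfun_scaleC_blinfun mult.assoc[symmetric])
qed

text \<open>The induction carries the series on the whole disc, since each further derivative needs
  a neighbourhood; only then is 0 inserted.\<close>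

lemma d_z_funpow_0:
  fixes B :: "'p \<Rightarrow> 'a::complex_hilbert \<Rightarrow>\<^sub>L 'b::complex_hilbert"
  assumes a: "\<And>p u. p \<in> I \<Longrightarrow> u \<in> disc \<Longrightarrow> (\<lambda>n. a p n * u ^ n) sums g p u"
    and F: "\<And>u. u \<in> disc \<Longrightarrow> F u = (\<Sum>p\<in>I. scaleC_blinfun (g p u) (B p))"
  shows "(d_z ^^ m) F 0 = (\<Sum>p\<in>I. scaleC_blinfun (fact m * a p m) (B p))"
proof -
  have "(\<forall>p\<in>I. \<forall>u\<in>disc. summable (\<lambda>n. (diffs ^^ m) (a p) n * u ^ n)) \<and>
    (\<forall>u\<in>disc. (d_z ^^ m) F u = (\<Sum>p\<in>I. scaleC_blinfun (\<Sum>n. (diffs ^^ m) (a p) n * u ^ n) (B p)))"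
  proof (induction m)
    case 0
    show ?case using a F by (auto simp: sums_iff intro!: sum.cong)
  next
    case (Suc m)
    then show ?case
      by (auto simp del: mem_ball_0 intro!: summable_diffs_disc d_z_power_series)
  qed
  then show ?thesis by (simp add: diffs_funpow_0)
qed

lemma d_zbar_funpow_0:
  fixes B :: "'p \<Rightarrow> 'a::complex_hilbert \<Rightarrow>\<^sub>L 'b::complex_hilbert"
  assumes a: "\<And>p u. p \<in> I \<Longrightarrow> u \<in> disc \<Longrightarrow> (\<lambda>n. a p n * cnj u ^ n) sums g p u"
    and F: "\<And>u. u \<in> disc \<Longrightarrow> F u = (\<Sum>p\<in>I. scaleC_blinfun (g p u) (B p))"
  shows "(d_zbar ^^ m) F 0 = (\<Sum>p\<in>I. scaleC_blinfun (fact m * a p m) (B p))"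
proof -
  have "(\<forall>p\<in>I. \<forall>u\<in>disc. summable (\<lambda>n. (diffs ^^ m) (a p) n * u ^ n)) \<and>
    (\<forall>u\<in>disc. (d_zbar ^^ m) F u = (\<Sum>p\<in>I. scaleC_blinfun (\<Sum>n. (diffs ^^ m) (a p) n * cnj u ^ n) (B p)))"
  proof (induction m)
    case 0
    \<comment> \<open>The hypothesis concerns powers of \<open>cnj u\<close>, so it is applied at
      \<open>cnj u\<close>.\<close>
    have "summable (\<lambda>n. a p n * u ^ n)" if "p \<in> I" "u \<in> disc" for p u
      using a[of p "cnj u"] that by (simp add: sums_iff)
    then show ?case using a F by (auto simp: sums_iff intro!: sum.cong)
  next
    case (Suc m)
    then show ?case
      by (auto simp del: mem_ball_0 intro!: summable_diffs_disc d_zbar_power_series)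
  qed
  then show ?thesis by (simp add: diffs_funpow_0)
qed

section \<open>The diagonal derivatives of the kernel at the origin\<close>

context operator_poly_rkhs
begin

text \<open>Scalar functions are separated from constant operators, the shape required by
  \<open>d_zbar_funpow_0\<close> and \<open>d_z_funpow_0\<close>.\<close>

lemma K\<^sub>P_expansion: "K\<^sub>P \<beta> d A z w = (\<Sum>p\<in>{..d} \<times> {..d}.
    scaleC_blinfun (z ^ fst p * cnj w ^ snd p * scalar_kernel \<beta> z w) (A (fst p) o\<^sub>L cadjoint (A (snd p))))"
proof (rule blinfun_eqI)
  fix x
  have lin: "blinfun_apply (A i) (\<Sum>j\<le>d. cnj w ^ j *\<^sub>C adj j x) = (\<Sum>j\<le>d. cnj w ^ j *\<^sub>C blinfun_apply (A i) (adj j x))"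
    if "i \<le> d" for i
    using A_linear[OF that] by (simp add: blinfun.sum_right complex_linear_def)
  have "blinfun_apply (K\<^sub>P \<beta> d A z w) x
      = (\<Sum>i\<le>d. \<Sum>j\<le>d. (z ^ i * cnj w ^ j * scalar_kernel \<beta> z w) *\<^sub>C blinfun_apply (A i) (adj j x))"
    by (simp add: K\<^sub>P_apply P_apply cadjoint_P_apply lin scaleC_sum_right scaleC_scaleC mult_ac cong: sum.cong_simp)
  then show "blinfun_apply (K\<^sub>P \<beta> d A z w) x = blinfun_apply (\<Sum>p\<in>{..d} \<times> {..d}.
    scaleC_blinfun (z ^ fst p * cnj w ^ snd p * scalar_kernel \<beta> z w) (A (fst p) o\<^sub>L cadjoint (A (snd p)))) x"
    by (simp add: blinfun.sum_left scaleC_blinfun.rep_eq adj_def sum.cartesian_product case_prod_unfold)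
qed

text \<open>For \<open>p = (i, j)\<close> with \<open>j \<le> n\<close>, the coefficient of
  \<open>cnj w ^ n\<close> is a multiple of \<open>z ^ (i + (n - j))\<close>, so the coefficient of
  \<open>z ^ n\<close> survives only for \<open>i = j\<close>. For \<open>j > n\<close> the factor
  \<open>b p\<close> is 0, and truncated subtraction does no harm.\<close>

lemma mixed_derivative_K\<^sub>P:
  "mixed_derivative n n (K\<^sub>P \<beta> d A) 0 0 = (\<Sum>p\<in>{..d} \<times> {..d}.
    scaleC_blinfun (if fst p = snd p \<and> snd p \<le> n then (fact n)\<^sup>2 * complex_of_real ((\<beta> (n - snd p))\<^sup>2) else 0)
      (A (fst p) o\<^sub>L cadjoint (A (snd p))))"
proof -
  define b where "b p = (if snd p \<le> n then fact n * complex_of_real ((\<beta> (n - snd p))\<^sup>2) else 0)" for p :: "nat \<times> nat"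
  have "(d_zbar ^^ n) (K\<^sub>P \<beta> d A z) 0 = (\<Sum>p\<in>{..d} \<times> {..d}.
      scaleC_blinfun (b p * z ^ (fst p + (n - snd p))) (A (fst p) o\<^sub>L cadjoint (A (snd p))))" if z: "z \<in> disc" for z
  proof -
    let ?a = "\<lambda>p m. z ^ fst p * (if snd p \<le> m then complex_of_real ((\<beta> (m - snd p))\<^sup>2) * z ^ (m - snd p) else 0)"
    have "(d_zbar ^^ n) (K\<^sub>P \<beta> d A z) 0 = (\<Sum>p\<in>{..d} \<times> {..d}.
        scaleC_blinfun (fact n * ?a p n) (A (fst p) o\<^sub>L cadjoint (A (snd p))))"
    proof (rule d_zbar_funpow_0[where a = ?a, OF _ K\<^sub>P_expansion])
      fix p and w :: complex assume w: "w \<in> disc"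
      have "(\<lambda>m. z ^ fst p * cnj w ^ snd p * (if snd p \<le> m then
            complex_of_real ((\<beta> (m - snd p))\<^sup>2) * z ^ (m - snd p) * cnj w ^ (m - snd p) else 0))
          sums (z ^ fst p * cnj w ^ snd p * scalar_kernel \<beta> z w)"
        by (intro sums_mult sums_shift_conv[THEN iffD2] scalar_kernel_sums z w)
      moreover have "z ^ fst p * cnj w ^ snd p * (if snd p \<le> m then
            complex_of_real ((\<beta> (m - snd p))\<^sup>2) * z ^ (m - snd p) * cnj w ^ (m - snd p) else 0)
          = ?a p m * cnj w ^ m" for m
        by (auto simp: le_iff_add power_add)
      ultimately show "(\<lambda>m. ?a p m * cnj w ^ m) sums (z ^ fst p * cnj w ^ snd p * scalar_kernel \<beta> z w)"
        by (simp only:)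
    qed
    also have "\<dots> = (\<Sum>p\<in>{..d} \<times> {..d}.
        scaleC_blinfun (b p * z ^ (fst p + (n - snd p))) (A (fst p) o\<^sub>L cadjoint (A (snd p))))"
      by (intro sum.cong arg_cong2[where f = scaleC_blinfun]) (auto simp: b_def power_add)
    finally show ?thesis .
  qed
  then have "mixed_derivative n n (K\<^sub>P \<beta> d A) 0 0 = (\<Sum>p\<in>{..d} \<times> {..d}.
      scaleC_blinfun (fact n * (if n = fst p + (n - snd p) then b p else 0)) (A (fst p) o\<^sub>L cadjoint (A (snd p))))"
    unfolding mixed_derivative_def
  proof (rule d_z_funpow_0[where a = "\<lambda>p m. if m = fst p + (n - snd p) then b p else 0", rotated])
    fix p :: "nat \<times> nat" and u :: complex
    have "(\<lambda>m. if m = fst p + (n - snd p) then b p * u ^ m else 0) sums (b p * u ^ (fst p + (n - snd p)))"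
      by (rule sums_single)
    then show "(\<lambda>m. (if m = fst p + (n - snd p) then b p else 0) * u ^ m) sums (b p * u ^ (fst p + (n - snd p)))"
      by (simp add: if_distrib[of "\<lambda>x. x * _"] cong: if_cong)
  qed
  also have "\<dots> = (\<Sum>p\<in>{..d} \<times> {..d}.
    scaleC_blinfun (if fst p = snd p \<and> snd p \<le> n then (fact n)\<^sup>2 * complex_of_real ((\<beta> (n - snd p))\<^sup>2) else 0)
      (A (fst p) o\<^sub>L cadjoint (A (snd p))))"
    by (intro sum.cong arg_cong2[where f = scaleC_blinfun]) (auto simp: b_def power2_eq_square)
  finally show ?thesis .
qed

text \<open>Only diagonal terms remain, and moving \<open>A j\<close> to the other side makes each a
  squared norm.\<close>

lemma cinner_mixed_derivative_K\<^sub>P: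
  "1 / (fact n)\<^sup>2 * cinner (blinfun_apply (mixed_derivative n n (K\<^sub>P \<beta> d A) 0 0) \<eta>) \<eta>
    = complex_of_real (\<Sum>j\<le>d. if j \<le> n then (\<beta> (n - j))\<^sup>2 * (norm (adj j \<eta>))\<^sup>2 else 0)"
proof -
  have "cinner (blinfun_apply (mixed_derivative n n (K\<^sub>P \<beta> d A) 0 0) \<eta>) \<eta>
      = (\<Sum>i\<le>d. \<Sum>j\<le>d. if j = i then if j \<le> n then (fact n)\<^sup>2 * complex_of_real ((\<beta> (n - j))\<^sup>2)
          * cinner (blinfun_apply (A i) (adj j \<eta>)) \<eta> else 0 else 0)"
    unfolding sum.cartesian_product
    by (simp add: mixed_derivative_K\<^sub>P blinfun.sum_left cinner_sum_left scaleC_blinfun.rep_eq cinner_scaleC_left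
        adj_def case_prod_unfold) (rule sum.cong, auto simp: adj_def)
  also have "\<dots> = (\<Sum>i\<le>d. if i \<le> n then (fact n)\<^sup>2 * complex_of_real ((\<beta> (n - i))\<^sup>2 * (norm (adj i \<eta>))\<^sup>2) else 0)"
    by (intro sum.cong) (auto simp: cinner_adj cinner_self)
  also have "\<dots> = (fact n)\<^sup>2 * complex_of_real (\<Sum>j\<le>d. if j \<le> n then (\<beta> (n - j))\<^sup>2 * (norm (adj j \<eta>))\<^sup>2 else 0)"
    by (auto simp: sum_distrib_left intro!: sum.cong)
  finally show ?thesis by simp
qed

text \<open>From left to right one vector \<open>\<eta>\<close> with
  \<open>adj 0 \<eta> \<noteq> 0\<close> suffices: the nonnegative term \<open>j = 0\<close> alone
  forces \<open>\<beta> (r k)\<close> to 0. Conversely, operator norms give a bound uniform in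
  \<open>\<eta>\<close>.\<close>

lemma liminf_zero_uniformly_iff:
  assumes A0: "\<exists>\<xi>. blinfun_apply (A 0) \<xi> \<noteq> 0"
  shows "liminf_zero_uniformly (ball (0::'e) 1)
       (\<lambda>n \<eta>. 1 / (fact n)\<^sup>2 * cinner (blinfun_apply (mixed_derivative n n (K\<^sub>P \<beta> d A) 0 0) \<eta>) \<eta>)
     \<longleftrightarrow> (\<exists>r. strict_mono r \<and> (\<lambda>k. \<beta> (r k)) \<longlonglongrightarrow> 0)"
    (is "?L \<longleftrightarrow> ?R")
proof
  let ?f = "\<lambda>n \<eta>. (\<Sum>j\<le>d. if j \<le> n then (\<beta> (n - j))\<^sup>2 * (norm (adj j \<eta>))\<^sup>2 else 0)"
  assume ?L
  then obtain r where r: "strict_mono r"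
    "uniform_limit (ball 0 1) (\<lambda>k \<eta>. complex_of_real (?f (r k) \<eta>)) (\<lambda>_. 0) sequentially"
    unfolding liminf_zero_uniformly_def cinner_mixed_derivative_K\<^sub>P by blast
  obtain \<xi> where "blinfun_apply (A 0) \<xi> \<noteq> 0"
    using A0 by blast
  define y where "y = blinfun_apply (A 0) \<xi>"
  \<comment> \<open>The pairing of \<open>\<xi>\<close> with \<open>adj 0 y\<close> is the squared
    norm of \<open>y\<close>.\<close>
  have "adj 0 y \<noteq> 0"
    using cinner_adj[of 0 \<xi> y] \<open>blinfun_apply (A 0) \<xi> \<noteq> 0\<close> by (auto simp: y_def cinner_self)
  define \<eta> where "\<eta> = (1 / (1 + norm y)) *\<^sub>R y"
  have "adj 0 \<eta> \<noteq> 0"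
    using \<open>adj 0 y \<noteq> 0\<close> norm_ge_zero[of y] by (simp add: \<eta>_def adj_def blinfun.scaleR_right add_nonneg_eq_0_iff)
  have "norm \<eta> = norm y / (1 + norm y)"
    using norm_ge_zero[of y] by (simp add: \<eta>_def)
  also have "\<dots> < 1"
    using add_pos_nonneg[OF zero_less_one norm_ge_zero[of y]] by (simp add: divide_less_eq)
  finally have "\<eta> \<in> ball 0 1"
    by simp
  from tendsto_Re[OF tendsto_uniform_limitI[OF r(2) this]]
  have lim: "(\<lambda>k. ?f (r k) \<eta>) \<longlonglongrightarrow> 0" by simp
  have "(\<lambda>k. \<beta> (r k) * norm (adj 0 \<eta>)) \<longlonglongrightarrow> 0"
  proof (rule tendsto_sandwich[OF _ _ tendsto_const])
    show "(\<lambda>k. sqrt (?f (r k) \<eta>)) \<longlonglongrightarrow> 0"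
      using tendsto_real_sqrt[OF lim] by simp
    have "\<beta> (r k) * norm (adj 0 \<eta>) \<le> sqrt (?f (r k) \<eta>)" for k
    proof (rule real_le_rsqrt)
      show "(\<beta> (r k) * norm (adj 0 \<eta>))\<^sup>2 \<le> ?f (r k) \<eta>"
        using member_le_sum[of 0 "{..d}" "\<lambda>j. if j \<le> r k then (\<beta> (r k - j))\<^sup>2 * (norm (adj j \<eta>))\<^sup>2 else 0"]
        by (simp add: power_mult_distrib)
    qed
    then show "eventually (\<lambda>k. \<beta> (r k) * norm (adj 0 \<eta>) \<le> sqrt (?f (r k) \<eta>)) sequentially"
      by simp
  qed (use beta_pos in \<open>simp add: less_imp_le\<close>)
  then have "(\<lambda>k. \<beta> (r k)) \<longlonglongrightarrow> 0"
    using \<open>adj 0 \<eta> \<noteq> 0\<close> tendsto_mult_right_iff[of "norm (adj 0 \<eta>)" "\<lambda>k. \<beta> (r k)" 0] by simp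
  with r(1) show ?R by blast
next
  let ?f = "\<lambda>n \<eta>. (\<Sum>j\<le>d. if j \<le> n then (\<beta> (n - j))\<^sup>2 * (norm (adj j \<eta>))\<^sup>2 else 0)"
  assume ?R
  then obtain r where r: "strict_mono r" "(\<lambda>k. \<beta> (r k)) \<longlonglongrightarrow> 0" by blast
  \<comment> \<open>Moving \<open>r\<close> by \<open>d\<close> puts all indices at or after
    \<open>r k\<close>, where \<open>weights_shift_tendsto_0\<close> applies.\<close>
  define C where "C k = (\<Sum>j\<le>d. (\<beta> (r k + (d - j)))\<^sup>2 * (norm (cadjoint (A j)))\<^sup>2)" for k
  have "C \<longlonglongrightarrow> (\<Sum>j\<le>d. 0\<^sup>2 * (norm (cadjoint (A j)))\<^sup>2)"
    unfolding C_def[abs_def]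
    by (intro tendsto_sum tendsto_mult tendsto_power tendsto_const weights_shift_tendsto_0[OF beta_pos beta_ratio r])
  then have "C \<longlonglongrightarrow> 0" by simp
  have bound: "cmod (complex_of_real (?f (r k + d) \<eta>)) \<le> C k" if "\<eta> \<in> ball 0 1" for k \<eta>
  proof -
    have "0 \<le> ?f (r k + d) \<eta>"
      by (intro sum_nonneg) simp
    moreover have "?f (r k + d) \<eta> \<le> C k"
      unfolding C_def
    proof (rule sum_mono)
      fix j assume "j \<in> {..d}"
      then have idx: "r k + d - j = r k + (d - j)" "j \<le> r k + d" by auto
      have "norm (adj j \<eta>) \<le> norm (cadjoint (A j)) * norm \<eta>"
        unfolding adj_def by (rule norm_blinfun)
      also have "\<dots> \<le> norm (cadjoint (A j))"
        using that by (intro mult_left_le) auto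
      finally show "(if j \<le> r k + d then (\<beta> (r k + d - j))\<^sup>2 * (norm (adj j \<eta>))\<^sup>2 else 0)
          \<le> (\<beta> (r k + (d - j)))\<^sup>2 * (norm (cadjoint (A j)))\<^sup>2"
        unfolding idx using idx(2) by (simp add: mult_left_mono power_mono)
    qed
    ultimately show ?thesis
      unfolding norm_of_real by linarith
  qed
  have "uniform_limit (ball 0 1) (\<lambda>k \<eta>. complex_of_real (?f (r k + d) \<eta>)) (\<lambda>_. 0) sequentially"
    unfolding uniform_limit_iff
  proof (intro allI impI)
    fix e :: real assume "e > 0"
    from order_tendstoD(2)[OF \<open>C \<longlonglongrightarrow> 0\<close> this]
    show "eventually (\<lambda>k. \<forall>\<eta>\<in>ball 0 1. dist (complex_of_real (?f (r k + d) \<eta>)) 0 < e) sequentially"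
    proof (rule eventually_mono, intro ballI)
      fix k and \<eta> :: 'e assume "C k < e" "\<eta> \<in> ball 0 1"
      then show "dist (complex_of_real (?f (r k + d) \<eta>)) 0 < e"
        unfolding dist_norm diff_zero using bound by (blast intro: le_less_trans)
    qed
  qed
  moreover have "strict_mono (\<lambda>k. r k + d)"
    using r(1) by (simp add: strict_mono_def)
  ultimately show ?L
    unfolding liminf_zero_uniformly_def cinner_mixed_derivative_K\<^sub>P by blast
qed

end

text \<open>The condition on \<open>\<beta>\<close> serves as hub for both equivalences.
  \<open>nonzero\<close> and \<open>A0_inj\<close> supply a vector not annihilated by
  \<open>A 0\<close>; \<open>separable\<close> supplies the countable dense set of coefficients for
  the Baire argument.\<close>

theorem theorem6p2:
  fixes \<beta> :: "nat \<Rightarrow> real"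
    and d :: nat
    and A :: "nat \<Rightarrow> 'e::complex_hilbert \<Rightarrow>\<^sub>L 'e"
    and ev :: "'h::complex_hilbert \<Rightarrow> complex \<Rightarrow> 'e"
    and M :: "'h \<Rightarrow>\<^sub>L 'h"
  assumes nonzero: "\<exists>x::'e. x \<noteq> 0"
    and separable: "separable_space (euclidean :: 'e topology)"
    and beta_pos: "\<And>n. \<beta> n > 0"
    and beta_ratio: "limsup (\<lambda>n. ereal (\<beta> (Suc n) / \<beta> n)) \<le> 1"
    and A_linear: "\<And>j. j \<le> d \<Longrightarrow> complex_linear (A j)"
    and A0_inj: "inj (blinfun_apply (A 0))"
    and H_P: "analytic_rkhs (K\<^sub>P \<beta> d A) ev"
    and Mz_bounded: "is_Mz ev M"
  shows "(hypercyclic (cadjoint M) \<longleftrightarrow> liminf (\<lambda>n. ereal (\<beta> n)) = 0) \<and>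
    (liminf_zero_uniformly (ball (0::'e) 1)
       (\<lambda>n \<eta>. 1 / (fact n)\<^sup>2 *
          cinner (blinfun_apply (mixed_derivative n n (K\<^sub>P \<beta> d A) 0 0) \<eta>) \<eta>)
     \<longleftrightarrow> liminf (\<lambda>n. ereal (\<beta> n)) = 0)"
proof -
  interpret operator_poly_shift \<beta> d A ev M
    using assms by unfold_locales auto
  obtain \<xi> where \<xi>: "blinfun_apply (A 0) \<xi> \<noteq> 0"
    using nonzero A0_inj by (metis blinfun.zero_right injD)
  have "hypercyclic (cadjoint M) \<longleftrightarrow> liminf (\<lambda>n. ereal (\<beta> n)) = 0"
  proof
    assume "hypercyclic (cadjoint M)"
    then show "liminf (\<lambda>n. ereal (\<beta> n)) = 0"
      using weights_bounded_below[of \<beta>] not_hypercyclic_if_bounded_below \<xi> beta_pos by metis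
  next
    assume "liminf (\<lambda>n. ereal (\<beta> n)) = 0"
    then show "hypercyclic (cadjoint M)"
      using hypercyclic_if_weights_small[OF separable] liminf_pos_eq_0_iff[of \<beta>] beta_pos by auto
  qed
  moreover have "liminf_zero_uniformly (ball (0::'e) 1)
       (\<lambda>n \<eta>. 1 / (fact n)\<^sup>2 * cinner (blinfun_apply (mixed_derivative n n (K\<^sub>P \<beta> d A) 0 0) \<eta>) \<eta>)
     \<longleftrightarrow> liminf (\<lambda>n. ereal (\<beta> n)) = 0"
    using liminf_zero_uniformly_iff \<xi> liminf_pos_eq_0_iff[of \<beta>] beta_pos by blast
  ultimately show ?thesis ..
qed

end
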